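(* Let $D>3$ be even. For $r=0,1,\dots,D$ let $B_r$ be an orthonormal basis of $\mathcal L_r$ consisting of real vectors, let $N_r=\{r,r+1,\dots,D\}$ if $r$ is even and $N_r=\{r,r+1,\dots,D-1\}$ if $r$ is odd, and let $\mathcal B_1=\{(r,\xi,i): 0\le r\le D,\ \xi\in B_r,\ i\in N_r\}$. For $(r,\xi,i)\in\mathcal B_1$ define $u_{r,\xi,i}=\binom{2D-2r}{i-r}^{-1/2}M^r_{i,r}\xi$ if $r\le i\le D-1$; $u_{r,\xi,D}=\frac{\sqrt2}{2}\binom{2D-2r}{D-r}^{-1/2}M^r_{D,r}\xi$ if $i=D$ and $r<D$ is even; and $u_{D,\xi,D}=\xi$. Let $U_1$ be the $X\times\mathcal B_1$ matrix whose $(r,\xi,i)$-column is $u_{r,\xi,i}$. Then $U_1$ gives a block-diagonalization of the Terwilliger algebra $T$: the columns of $U_1$ form an orthonormal basis of $\mathbb C^X$, and for every $M\in T$ the entry of $U_1^{\mathrm T}MU_1$ in position $((r,\xi,i),(r',\xi',j))$ vanishes unless $(r,\xi)=(r',\xi')$, each block (rows and columns indexed by $N_r$) depending only on $r$. Moreover $T$ is isomorphic to $\bigoplus_{r=0}^D\mathbb C^{N_r\times N_r}$.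
   Context: Let $S=\{1,\dots,2D\}$, $X$ the set of unordered pairs $\{u,u'\}$ of subsets of $S$ with $u\cap u'=\emptyset$, $u\cup u'=S$. The folded cube $\square_{2D}$ is the graph on $X$ with distance $\partial(x,y)=\min\{|x_1\triangle y_1|,|x_1\triangle y_2|\}$ for $x=\{x_1,x_2\},y=\{y_1,y_2\}$ (adjacent iff distance $1$); its diameter is $D$. Let $\mathbf 0=\{\emptyset,S\}$. Write each vertex as $x=(x_1,x_2)$ with parts labeled so that $|x_1|\le|x_2|$ (arbitrarily if $|x_1|=|x_2|=D$). For $x,y\in X$ put $\partial(\mathbf 0,x,y)=(i,j,t)$ where $i=|x_1|$, $j=|y_1|$ and $t=|x_1\cap y_1|$ if $i,j\le D-1$; $t=\max\{|x_1\cap y_1|,|x_2\cap y_1|\}$ if $i=D$, $j\le D-1$; $t=\max\{|x_1\cap y_1|,|x_1\cap y_2|\}$ if $i\le D-1$, $j=D$ or if $i=j=D$. Let $\mathcal I=\{(i,j,t): 0\le t\le i,j\le D,\ i+j-t\le 2D-2,\ t\ge\lfloor (j+1)/2\rfloor \text{ if } i=D,\ t\ge\lfloor (i+1)/2\rfloor\text{ if } j=D\}$. For $(i,j,t)\in\mathcal I$, $M^t_{i,j}$ is the $X\times X$ matrix with $(x,y)$-entry $1$ if $\partial(\mathbf 0,x,y)=(i,j,t)$ and $0$ otherwise. For $0\le r\le D$, $\mathcal L_r=\{\xi\in\mathbb C^X: \xi_x=0 \text{ whenever } |x_1|\neq r,\ M^{r-1}_{r-1,r}\xi=0\}$ (for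 $r=0$ the second condition is void). $A_k$ is the distance-$k$ matrix, $E^*_k$ the diagonal matrix with $(y,y)$-entry $1$ iff $\partial(\mathbf 0,y)=k$, and the Terwilliger algebra $T$ (with respect to $\mathbf 0$) is the subalgebra of $\mathrm{Mat}_X(\mathbb C)$ generated by $A_0,\dots,A_D,E^*_0,\dots,E^*_D$.
   Formalization: The column u_{0,ξ,D} is taken with factor √2 instead of √2/2: with √2/2 its squared norm is 1/4, since M^0_{D,0}ξ has squared norm binom(2D,D)/2, so the columns would not be orthonormal; all other columns are as stated. *)

theory Defs
  imports "HOL-Analysis.Analysis" "HOL-Library.Function_Algebras"
begin

text \<open>
  The space \<open>\<complex>\<^sup>K\<close> and the algebra \<open>Mat\<^sub>K(\<complex>)\<close> over a finite index set \<open>K\<close> are modelled by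
  complex-valued functions vanishing outside \<open>K\<close> and \<open>K \<times> K\<close>.  Sums of such functions are
  pointwise; the pointwise product of functions is never used.
\<close>

definition cscale :: "complex \<Rightarrow> ('k \<Rightarrow> complex) \<Rightarrow> 'k \<Rightarrow> complex" where
  "cscale c v = (\<lambda>x. c * v x)"

interpretation cvec: vector_space cscale
  by unfold_locales (auto simp: cscale_def algebra_simps fun_eq_iff)

definition cvectors :: "'k set \<Rightarrow> ('k \<Rightarrow> complex) set" where
  "cvectors K = {v. \<forall>x. x \<notin> K \<longrightarrow> v x = 0}"

definition cinner_on :: "'k set \<Rightarrow> ('k \<Rightarrow> complex) \<Rightarrow> ('k \<Rightarrow> complex) \<Rightarrow> complex" where
  "cinner_on K v w = (\<Sum>x\<in>K. cnj (v x) * w x)"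

definition orthonormal_basis_on ::
    "'k set \<Rightarrow> 'b set \<Rightarrow> ('b \<Rightarrow> 'k \<Rightarrow> complex) \<Rightarrow> ('k \<Rightarrow> complex) set \<Rightarrow> bool" where
  "orthonormal_basis_on K I v W \<longleftrightarrow>
     (\<forall>a\<in>I. \<forall>b\<in>I. cinner_on K (v a) (v b) = (if a = b then 1 else 0)) \<and>
     cvec.independent (v ` I) \<and> cvec.span (v ` I) = W"

definition mat_space :: "'k set \<Rightarrow> ('k \<Rightarrow> 'k \<Rightarrow> complex) set" where
  "mat_space K = {M. \<forall>x y. x \<notin> K \<or> y \<notin> K \<longrightarrow> M x y = 0}"

definition mat_one :: "'k set \<Rightarrow> 'k \<Rightarrow> 'k \<Rightarrow> complex" where
  "mat_one K = (\<lambda>x y. if x \<in> K \<and> x = y then 1 else 0)"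

definition mat_scale :: "complex \<Rightarrow> ('i \<Rightarrow> 'j \<Rightarrow> complex) \<Rightarrow> 'i \<Rightarrow> 'j \<Rightarrow> complex" where
  "mat_scale c M = (\<lambda>x y. c * M x y)"

definition mat_mul ::
    "'k set \<Rightarrow> ('i \<Rightarrow> 'k \<Rightarrow> complex) \<Rightarrow> ('k \<Rightarrow> 'j \<Rightarrow> complex) \<Rightarrow> 'i \<Rightarrow> 'j \<Rightarrow> complex" where
  "mat_mul K M N = (\<lambda>x y. \<Sum>z\<in>K. M x z * N z y)"

definition mat_vec :: "'k set \<Rightarrow> ('i \<Rightarrow> 'k \<Rightarrow> complex) \<Rightarrow> ('k \<Rightarrow> complex) \<Rightarrow> 'i \<Rightarrow> complex" where
  "mat_vec K M v = (\<lambda>x. \<Sum>y\<in>K. M x y * v y)"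

definition mat_transpose :: "('i \<Rightarrow> 'j \<Rightarrow> complex) \<Rightarrow> 'j \<Rightarrow> 'i \<Rightarrow> complex" where
  "mat_transpose M = (\<lambda>x y. M y x)"

definition mat_subalgebra :: "'k set \<Rightarrow> ('k \<Rightarrow> 'k \<Rightarrow> complex) set \<Rightarrow> bool" where
  "mat_subalgebra K \<A> \<longleftrightarrow>
     \<A> \<subseteq> mat_space K \<and> mat_one K \<in> \<A> \<and>
     (\<forall>M\<in>\<A>. \<forall>N\<in>\<A>. M + N \<in> \<A> \<and> mat_mul K M N \<in> \<A>) \<and>
     (\<forall>c. \<forall>M\<in>\<A>. mat_scale c M \<in> \<A>)"

definition generated_subalgebra ::
    "'k set \<Rightarrow> ('k \<Rightarrow> 'k \<Rightarrow> complex) set \<Rightarrow> ('k \<Rightarrow> 'k \<Rightarrow> complex) set" where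
  "generated_subalgebra K G = \<Inter>{\<A>. mat_subalgebra K \<A> \<and> G \<subseteq> \<A>}"


type_synonym vertex = "nat set set"
type_synonym labelling = "vertex \<Rightarrow> nat set \<times> nat set"

definition fc_ground :: "nat \<Rightarrow> nat set" where
  "fc_ground D = {1..2 * D}"

definition fc_vertices :: "nat \<Rightarrow> vertex set" where
  "fc_vertices D = {{u, u'} | u u'. u \<inter> u' = {} \<and> u \<union> u' = fc_ground D}"

definition fc_zero :: "nat \<Rightarrow> vertex" where
  "fc_zero D = {{}, fc_ground D}"

text \<open>
  A labelling writes every vertex as \<open>(x\<^sub>1, x\<^sub>2)\<close> with \<open>|x\<^sub>1| \<le> |x\<^sub>2|\<close>.  It is carried as a parameter
  because the choice is arbitrary when both parts have \<open>D\<close> elements.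
\<close>

definition fc_labelling :: "nat \<Rightarrow> labelling \<Rightarrow> bool" where
  "fc_labelling D lab \<longleftrightarrow>
     (\<forall>x\<in>fc_vertices D. x = {fst (lab x), snd (lab x)} \<and> card (fst (lab x)) \<le> card (snd (lab x)))"

definition fc_dist :: "labelling \<Rightarrow> vertex \<Rightarrow> vertex \<Rightarrow> nat" where
  "fc_dist lab x y =
     (let (x\<^sub>1, x\<^sub>2) = lab x; (y\<^sub>1, y\<^sub>2) = lab y
      in min (card (sym_diff x\<^sub>1 y\<^sub>1)) (card (sym_diff x\<^sub>1 y\<^sub>2)))"

text \<open>The triple \<open>\<partial>(0, x, y)\<close>.\<close>

definition fc_triple :: "nat \<Rightarrow> labelling \<Rightarrow> vertex \<Rightarrow> vertex \<Rightarrow> nat \<times> nat \<times> nat" where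
  "fc_triple D lab x y =
     (let (x\<^sub>1, x\<^sub>2) = lab x; (y\<^sub>1, y\<^sub>2) = lab y; i = card x\<^sub>1; j = card y\<^sub>1
      in (i, j,
          if i \<le> D - 1 \<and> j \<le> D - 1 then card (x\<^sub>1 \<inter> y\<^sub>1)
          else if i = D \<and> j \<le> D - 1 then max (card (x\<^sub>1 \<inter> y\<^sub>1)) (card (x\<^sub>2 \<inter> y\<^sub>1))
          else max (card (x\<^sub>1 \<inter> y\<^sub>1)) (card (x\<^sub>1 \<inter> y\<^sub>2))))"

text \<open>\<open>fc_M D lab i j t\<close> is \<open>M\<close> with lower indices \<open>i, j\<close> and upper index \<open>t\<close>.\<close>

definition fc_M :: "nat \<Rightarrow> labelling \<Rightarrow> nat \<Rightarrow> nat \<Rightarrow> nat \<Rightarrow> vertex \<Rightarrow> vertex \<Rightarrow> complex" where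
  "fc_M D lab i j t = (\<lambda>x y.
     if x \<in> fc_vertices D \<and> y \<in> fc_vertices D \<and> fc_triple D lab x y = (i, j, t) then 1 else 0)"

definition fc_L :: "nat \<Rightarrow> labelling \<Rightarrow> nat \<Rightarrow> (vertex \<Rightarrow> complex) set" where
  "fc_L D lab r = {\<xi> \<in> cvectors (fc_vertices D).
     (\<forall>x\<in>fc_vertices D. card (fst (lab x)) \<noteq> r \<longrightarrow> \<xi> x = 0) \<and>
     (r > 0 \<longrightarrow> mat_vec (fc_vertices D) (fc_M D lab (r - 1) r (r - 1)) \<xi> = 0)}"

definition fc_A :: "nat \<Rightarrow> labelling \<Rightarrow> nat \<Rightarrow> vertex \<Rightarrow> vertex \<Rightarrow> complex" where
  "fc_A D lab k = (\<lambda>x y.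
     if x \<in> fc_vertices D \<and> y \<in> fc_vertices D \<and> fc_dist lab x y = k then 1 else 0)"

definition fc_Estar :: "nat \<Rightarrow> labelling \<Rightarrow> nat \<Rightarrow> vertex \<Rightarrow> vertex \<Rightarrow> complex" where
  "fc_Estar D lab k = (\<lambda>x y.
     if x \<in> fc_vertices D \<and> x = y \<and> fc_dist lab (fc_zero D) y = k then 1 else 0)"

definition fc_T :: "nat \<Rightarrow> labelling \<Rightarrow> (vertex \<Rightarrow> vertex \<Rightarrow> complex) set" where
  "fc_T D lab = generated_subalgebra (fc_vertices D) (fc_A D lab ` {0..D} \<union> fc_Estar D lab ` {0..D})"


definition fc_N :: "nat \<Rightarrow> nat \<Rightarrow> nat set" where
  "fc_N D r = (if even r then {r..D} else {r..D - 1})"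

definition fc_B1 ::
    "nat \<Rightarrow> (nat \<Rightarrow> (vertex \<Rightarrow> complex) set) \<Rightarrow> (nat \<times> (vertex \<Rightarrow> complex) \<times> nat) set" where
  "fc_B1 D B = {(r, \<xi>, i). r \<le> D \<and> \<xi> \<in> B r \<and> i \<in> fc_N D r}"

text \<open>
  The column \<open>(0, \<xi>, D)\<close> needs the factor \<open>\<surd>2\<close> instead of the uniform \<open>\<surd>2/2\<close>.  For \<open>r > 0\<close> at most
  one part of a vertex of level \<open>D\<close> contains a given \<open>r\<close>-set, but for \<open>r = 0\<close> both parts contain
  the empty set, while the matrix entry is still 1.  Hence the vector \<open>M \<xi>\<close> for \<open>(i, j, t) = (D, 0, 0)\<close>
  has squared norm \<open>(2D choose D) / 2\<close>, the number of vertices of level \<open>D\<close>, as opposed to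
  \<open>2 ((2D - 2r) choose (D - r))\<close> for even \<open>r\<close> with \<open>0 < r < D\<close>; with \<open>\<surd>2/2\<close> the column
  would have squared norm 1/4.
\<close>

definition fc_u :: "nat \<Rightarrow> labelling \<Rightarrow> nat \<Rightarrow> (vertex \<Rightarrow> complex) \<Rightarrow> nat \<Rightarrow> vertex \<Rightarrow> complex" where
  "fc_u D lab r \<xi> i =
     (if i \<le> D - 1 then
        cscale (of_real (1 / sqrt (real ((2 * D - 2 * r) choose (i - r)))))
          (mat_vec (fc_vertices D) (fc_M D lab i r r) \<xi>)
      else if r = D then \<xi>
      else
        cscale (of_real ((if r = 0 then sqrt 2 else sqrt 2 / 2)
                         * (1 / sqrt (real ((2 * D - 2 * r) choose (D - r))))))
          (mat_vec (fc_vertices D) (fc_M D lab D r r) \<xi>))"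

definition fc_U1 ::
    "nat \<Rightarrow> labelling \<Rightarrow> vertex \<Rightarrow> nat \<times> (vertex \<Rightarrow> complex) \<times> nat \<Rightarrow> complex" where
  "fc_U1 D lab = (\<lambda>x (r, \<xi>, i). fc_u D lab r \<xi> i x)"

definition fc_conj ::
    "nat \<Rightarrow> labelling \<Rightarrow> (vertex \<Rightarrow> vertex \<Rightarrow> complex) \<Rightarrow>
     nat \<times> (vertex \<Rightarrow> complex) \<times> nat \<Rightarrow> nat \<times> (vertex \<Rightarrow> complex) \<times> nat \<Rightarrow> complex" where
  "fc_conj D lab M =
     mat_mul (fc_vertices D)
       (mat_mul (fc_vertices D) (mat_transpose (fc_U1 D lab)) M) (fc_U1 D lab)"


text \<open>The direct sum of the algebras \<open>Mat\<^sub>N\<^sub>(\<^sub>r\<^sub>)(\<complex>)\<close> for \<open>r \<le> D\<close>, as families that are 0 for \<open>r > D\<close>.\<close>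

definition block_sum :: "nat \<Rightarrow> (nat \<Rightarrow> nat set) \<Rightarrow> (nat \<Rightarrow> nat \<Rightarrow> nat \<Rightarrow> complex) set" where
  "block_sum D N = {F. (\<forall>r\<le>D. F r \<in> mat_space (N r)) \<and> (\<forall>r>D. F r = 0)}"

definition block_one :: "nat \<Rightarrow> (nat \<Rightarrow> nat set) \<Rightarrow> nat \<Rightarrow> nat \<Rightarrow> nat \<Rightarrow> complex" where
  "block_one D N = (\<lambda>r. if r \<le> D then mat_one (N r) else 0)"

definition iso_to_block_sum ::
    "'k set \<Rightarrow> ('k \<Rightarrow> 'k \<Rightarrow> complex) set \<Rightarrow> nat \<Rightarrow> (nat \<Rightarrow> nat set) \<Rightarrow> bool" where
  "iso_to_block_sum K \<A> D N \<longleftrightarrow>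
     (\<exists>\<phi>. bij_betw \<phi> \<A> (block_sum D N) \<and>
          \<phi> (mat_one K) = block_one D N \<and>
          (\<forall>P\<in>\<A>. \<forall>Q\<in>\<A>. \<phi> (P + Q) = \<phi> P + \<phi> Q) \<and>
          (\<forall>c. \<forall>P\<in>\<A>. \<phi> (mat_scale c P) = (\<lambda>r. mat_scale c (\<phi> P r))) \<and>
          (\<forall>P\<in>\<A>. \<forall>Q\<in>\<A>. \<phi> (mat_mul K P Q) = (\<lambda>r. mat_mul (N r) (\<phi> P r) (\<phi> Q r))))"

end

theory Submission
  imports Defs
begin

text \<open>
  A function \<open>g\<close> on the \<open>r\<close>-subsets of \<open>S\<close> that is killed by the lowering map extends to
  \<open>F(u) = \<Sum>w\<subseteq>u. g(w)\<close>, and \<open>F\<close> is an eigenvector of both neighbour sums at every level: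
  \<open>\<Sum>s\<in>u. F(u - s) = (|u| - r) F(u)\<close> and \<open>\<Sum>s\<notin>u. F(u + s) = (2D - |u| - r) F(u)\<close>.  Comparing
  these two identities for adjacent levels gives the orthogonality of different \<open>r\<close> and the binomial
  norms, and inclusion-exclusion gives \<open>F(S - u) = (-1)\<^sup>r F(u)\<close>, so that \<open>F\<close> survives at level \<open>D\<close> of the
  folded cube exactly for even \<open>r\<close>.  The columns of \<open>U\<^sub>1\<close> are the normalised levels of such \<open>F\<close>; they
  span because a vector of level \<open>i\<close> orthogonal to them is killed by lowering (induction on \<open>i\<close>) and
  hence lies in the span of \<open>B\<^sub>i\<close>.

  On the columns \<open>A\<^sub>1\<close> acts tridiagonally with coefficients independent of \<open>\<xi>\<close>, and each \<open>A\<^sub>k\<close> is a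
  polynomial in \<open>A\<^sub>1\<close>, so \<open>T\<close> is block diagonal.  Conversely, raising from level \<open>s\<close> to \<open>i\<close> after lowering from
  \<open>j\<close> to \<open>s\<close> is a nonzero multiple of the \<open>(i, j)\<close> matrix unit on block \<open>s\<close> and vanishes on all blocks
  \<open>r > s\<close>; by triangularity in \<open>s\<close> every matrix unit of every block lies in \<open>T\<close>.
\<close>

section \<open>Ladder functions on the subset lattice\<close>

definition subset_sum :: "('a set \<Rightarrow> complex) \<Rightarrow> 'a set \<Rightarrow> complex" where
  "subset_sum g u = (\<Sum>w\<in>Pow u. g w)"

text \<open>These are the lowest-weight vectors of weight \<open>r\<close> for the sl_2 action on
  functions on the subsets of \<open>S\<close>. Letting \<open>a\<close> range over all subsets
  avoids a truncated \<open>r - 1\<close>.\<close>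

definition primitive :: "'a set \<Rightarrow> nat \<Rightarrow> ('a set \<Rightarrow> complex) \<Rightarrow> bool" where
  "primitive S r g \<longleftrightarrow>
     (\<forall>w\<subseteq>S. card w \<noteq> r \<longrightarrow> g w = 0) \<and> (\<forall>a\<subseteq>S. (\<Sum>s\<in>S - a. g (insert s a)) = 0)"

text \<open>The interface for the inner product computations. The eigenvalues are differences in
  \<complex>, so nothing is truncated, and the last clause starts the induction at the empty
  set.\<close>

definition ladder :: "'a set \<Rightarrow> nat \<Rightarrow> ('a set \<Rightarrow> complex) \<Rightarrow> bool" where
  "ladder S r F \<longleftrightarrow>
     (\<forall>u\<subseteq>S. (\<Sum>s\<in>u. F (u - {s})) = (of_nat (card u) - of_nat r) * F u) \<and>
     (\<forall>u\<subseteq>S. (\<Sum>s\<in>S - u. F (insert s u)) = (of_nat (card S) - of_nat (card u) - of_nat r) * F u) \<and>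
     (\<forall>u\<subseteq>S. card u < r \<longrightarrow> F u = 0)"

lemma subset_sum_insert:
  assumes "finite u" "s \<notin> u"
  shows "subset_sum g (insert s u) = subset_sum g u + (\<Sum>w\<in>Pow u. g (insert s w))"
proof -
  have "inj_on (insert s) (Pow u)"
    using assms(2) by (auto simp: inj_on_def)
  moreover have "Pow u \<inter> insert s ` Pow u = {}"
    using assms(2) by auto
  ultimately show ?thesis
    unfolding subset_sum_def Pow_insert using assms(1)
    by (simp add: sum.union_disjoint sum.reindex)
qed

text \<open>Double counting: a subset \<open>w\<close> of \<open>u\<close> survives in
  \<open>u - {s}\<close> exactly for \<open>s\<close> in \<open>u - w\<close>.\<close>

lemma sum_subset_sum_remove:
  assumes "finite u"
  shows "(\<Sum>s\<in>u. subset_sum g (u - {s})) = (\<Sum>w\<in>Pow u. of_nat (card (u - w)) * g w)"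
proof -
  have "(\<Sum>s\<in>u. subset_sum g (u - {s})) = (\<Sum>s\<in>u. \<Sum>w\<in>Pow u. if s \<notin> w then g w else 0)"
  proof (rule sum.cong[OF refl])
    fix s assume "s \<in> u"
    have "Pow (u - {s}) = {w \<in> Pow u. s \<notin> w}" by auto
    then show "subset_sum g (u - {s}) = (\<Sum>w\<in>Pow u. if s \<notin> w then g w else 0)"
      unfolding subset_sum_def using assms by (simp only: sum.inter_filter[OF finite_Pow_iff[THEN iffD2]])
  qed
  also have "\<dots> = (\<Sum>w\<in>Pow u. \<Sum>s\<in>u. if s \<notin> w then g w else 0)"
    by (rule sum.swap)
  also have "\<dots> = (\<Sum>w\<in>Pow u. of_nat (card (u - w)) * g w)"
  proof (rule sum.cong[OF refl])
    fix w
    have "(\<Sum>s\<in>u. if s \<notin> w then g w else 0) = (\<Sum>s\<in>{s\<in>u. s \<notin> w}. g w)"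
      using assms by (simp only: sum.inter_filter)
    also have "{s\<in>u. s \<notin> w} = u - w" by auto
    finally show "(\<Sum>s\<in>u. if s \<notin> w then g w else 0) = of_nat (card (u - w)) * g w" by simp
  qed
  finally show ?thesis .
qed

text \<open>The pairs \<open>(w, s)\<close> with \<open>s\<close> outside \<open>w\<close>
  correspond to the pairs \<open>(v, s)\<close> with \<open>s\<close> in \<open>v\<close>, via
  \<open>v = insert s w\<close>.\<close>

lemma sum_insert_subsets:
  assumes "finite u"
  shows "(\<Sum>w\<in>Pow u. \<Sum>s\<in>u - w. g (insert s w)) = (\<Sum>v\<in>Pow u. of_nat (card v) * (g v :: complex))"
proof -
  have fin: "finite w" if "w \<in> Pow u" for w
    using assms that by (auto intro: finite_subset)
  have "(\<Sum>w\<in>Pow u. \<Sum>s\<in>u - w. g (insert s w)) = (\<Sum>(w, s)\<in>Sigma (Pow u) (\<lambda>w. u - w). g (insert s w))"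
    using assms by (subst sum.Sigma) auto
  also have "\<dots> = (\<Sum>(v, s)\<in>Sigma (Pow u) (\<lambda>v. v). g v)"
    by (rule sum.reindex_bij_witness[where i = "\<lambda>(v, s). (v - {s}, s)" and j = "\<lambda>(w, s). (insert s w, s)"])
      (auto simp: insert_absorb)
  also have "\<dots> = (\<Sum>v\<in>Pow u. \<Sum>s\<in>v. g v)"
    using assms fin by (subst sum.Sigma) auto
  finally show ?thesis by simp
qed

text \<open>Deleting points counts each \<open>r\<close>-subset of \<open>u\<close> once for every
  point of \<open>u\<close> outside it. Adding a point \<open>s\<close> keeps the old sum and adds
  the sets through \<open>s\<close>; primitivity evaluates the total of the latter as
  \<open>-r\<close> times the old sum.\<close>

lemma ladder_subset_sum:
  assumes fin: "finite S" and g: "primitive S r g"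
  shows "ladder S r (subset_sum g)"
  unfolding ladder_def
proof (intro conjI allI impI)
  fix u assume u: "u \<subseteq> S"
  then have finu: "finite u" using fin finite_subset by blast
  have supp: "g w = 0" if "w \<subseteq> u" "card w \<noteq> r" for w
    using g that u by (auto simp: primitive_def)
  \<comment> \<open>As \<open>g\<close> lives on the \<open>r\<close>-sets, a weight depending only
    on \<open>card w\<close> factors out with its value at \<open>r\<close>.\<close>
  have weight: "(\<Sum>w\<in>Pow u. (h (card w)) * g w) = h r * subset_sum g u" for h :: "nat \<Rightarrow> complex"
    unfolding subset_sum_def sum_distrib_left
  proof (rule sum.cong[OF refl])
    fix w assume "w \<in> Pow u"
    then show "h (card w) * g w = h r * g w" using supp[of w] by (cases "card w = r") auto
  qed
  have "(\<Sum>s\<in>u. subset_sum g (u - {s})) = (\<Sum>w\<in>Pow u. (of_nat (card u) - of_nat (card w)) * g w)"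
    unfolding sum_subset_sum_remove[OF finu]
    by (rule sum.cong[OF refl])
      (use finu in \<open>auto simp: card_Diff_subset finite_subset of_nat_diff card_mono\<close>)
  then show "(\<Sum>s\<in>u. subset_sum g (u - {s})) = (of_nat (card u) - of_nat r) * subset_sum g u"
    using weight[of "\<lambda>k. of_nat (card u) - of_nat k"] by simp
  have "(\<Sum>s\<in>S - u. subset_sum g (insert s u))
      = (\<Sum>s\<in>S - u. subset_sum g u + (\<Sum>w\<in>Pow u. g (insert s w)))"
    by (rule sum.cong[OF refl]) (use finu in \<open>simp add: subset_sum_insert\<close>)
  also have "\<dots> = of_nat (card (S - u)) * subset_sum g u + (\<Sum>w\<in>Pow u. \<Sum>s\<in>S - u. g (insert s w))"
    unfolding sum.distrib by (subst (2) sum.swap) simp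
  \<comment> \<open>Primitivity at \<open>w\<close> trades the points outside \<open>u\<close> for
    those of \<open>u - w\<close>, at the cost of a sign.\<close>
  also have "(\<Sum>w\<in>Pow u. \<Sum>s\<in>S - u. g (insert s w)) = (\<Sum>w\<in>Pow u. - (\<Sum>s\<in>u - w. g (insert s w)))"
  proof (rule sum.cong[OF refl])
    fix w assume w: "w \<in> Pow u"
    have "(\<Sum>s\<in>S - w. g (insert s w)) = 0"
      using g w u by (auto simp: primitive_def)
    moreover have "S - w = (S - u) \<union> (u - w)" using w u by auto
    moreover have "(\<Sum>s\<in>(S - u) \<union> (u - w). g (insert s w))
        = (\<Sum>s\<in>S - u. g (insert s w)) + (\<Sum>s\<in>u - w. g (insert s w))"
      using fin finu by (intro sum.union_disjoint) auto
    ultimately show "(\<Sum>s\<in>S - u. g (insert s w)) = - (\<Sum>s\<in>u - w. g (insert s w))"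
      by (simp add: eq_neg_iff_add_eq_0)
  qed
  also have "\<dots> = - (of_nat r * subset_sum g u)"
    unfolding sum_negf sum_insert_subsets[OF finu] using weight[of of_nat] by simp
  also have "of_nat (card (S - u)) = (of_nat (card S) - of_nat (card u) :: complex)"
    using u fin finu by (simp add: card_Diff_subset card_mono of_nat_diff)
  finally show "(\<Sum>s\<in>S - u. subset_sum g (insert s u))
      = (of_nat (card S) - of_nat (card u) - of_nat r) * subset_sum g u"
    by (simp add: algebra_simps)
  show "subset_sum g u = 0" if "card u < r"
    unfolding subset_sum_def
  proof (rule sum.neutral, rule ballI)
    fix w assume w: "w \<in> Pow u"
    then have "card w \<le> card u" using finu by (simp add: card_mono)
    then show "g w = 0" using supp w that by simp
  qed
qed

text \<open>Induction on \<open>k = r - card a\<close>. Adding up the superset sums of all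
  \<open>insert s a\<close> counts each \<open>r\<close>-set containing \<open>a\<close> exactly
  \<open>k\<close> times, so the sum for \<open>a\<close> is a nonzero multiple smaller than sums
  already known to vanish; \<open>k = 1\<close> is primitivity itself.\<close>

lemma primitive_sum_supersets:
  assumes fin: "finite S" and g: "primitive S r g" and "a \<subseteq> S" "card a + k = r" "k > 0"
  shows "(\<Sum>w | a \<subseteq> w \<and> w \<subseteq> S. g w) = 0"
  using assms(3-)
proof (induction k arbitrary: a)
  case 0
  then show ?case by simp
next
  case (Suc k)
  have supp: "g w = 0" if "w \<subseteq> S" "card w \<noteq> r" for w
    using g that by (auto simp: primitive_def)
  have fina: "finite a" using Suc.prems fin finite_subset by blast
  have "(\<Sum>s\<in>S - a. \<Sum>w | insert s a \<subseteq> w \<and> w \<subseteq> S. g w) = 0"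
  proof (cases "k = 0")
    case True
    have "(\<Sum>w | insert s a \<subseteq> w \<and> w \<subseteq> S. g w) = g (insert s a)" if s: "s \<in> S - a" for s
    proof -
      have "(\<Sum>w | insert s a \<subseteq> w \<and> w \<subseteq> S. g w) = (\<Sum>w\<in>{insert s a}. g w)"
      proof (rule sum.mono_neutral_right)
        show "finite {w. insert s a \<subseteq> w \<and> w \<subseteq> S}" using fin by simp
        show "{insert s a} \<subseteq> {w. insert s a \<subseteq> w \<and> w \<subseteq> S}" using s Suc.prems by auto
        show "\<forall>w\<in>{w. insert s a \<subseteq> w \<and> w \<subseteq> S} - {insert s a}. g w = 0"
        proof
          fix w assume w: "w \<in> {w. insert s a \<subseteq> w \<and> w \<subseteq> S} - {insert s a}"
          then have "card (insert s a) < card w"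
            using fin by (intro psubset_card_mono) (auto intro: finite_subset)
          then have "card w \<noteq> r" using s fina Suc.prems True by simp
          then show "g w = 0" using supp w by blast
        qed
      qed
      then show ?thesis by simp
    qed
    then show ?thesis using g Suc.prems by (simp add: primitive_def)
  next
    case False
    have "(\<Sum>w | insert s a \<subseteq> w \<and> w \<subseteq> S. g w) = 0" if "s \<in> S - a" for s
      using Suc.IH[of "insert s a"] that Suc.prems False fina by simp
    then show ?thesis by simp
  qed
  also have "(\<Sum>s\<in>S - a. \<Sum>w | insert s a \<subseteq> w \<and> w \<subseteq> S. g w)
      = (\<Sum>s\<in>S - a. \<Sum>w | a \<subseteq> w \<and> w \<subseteq> S. if s \<in> w then g w else 0)"
  proof (rule sum.cong[OF refl])
    fix s
    have "{w. insert s a \<subseteq> w \<and> w \<subseteq> S} = {w \<in> {w. a \<subseteq> w \<and> w \<subseteq> S}. s \<in> w}" by auto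
    moreover have "finite {w. a \<subseteq> w \<and> w \<subseteq> S}" using fin by simp
    ultimately show "(\<Sum>w | insert s a \<subseteq> w \<and> w \<subseteq> S. g w)
        = (\<Sum>w | a \<subseteq> w \<and> w \<subseteq> S. if s \<in> w then g w else 0)"
      by (simp only: sum.inter_filter)
  qed
  also have "\<dots> = (\<Sum>w | a \<subseteq> w \<and> w \<subseteq> S. \<Sum>s\<in>S - a. if s \<in> w then g w else 0)"
    by (rule sum.swap)
  also have "\<dots> = (\<Sum>w | a \<subseteq> w \<and> w \<subseteq> S. of_nat (Suc k) * g w)"
  proof (rule sum.cong[OF refl])
    fix w assume w: "w \<in> {w. a \<subseteq> w \<and> w \<subseteq> S}"
    have "(\<Sum>s\<in>S - a. if s \<in> w then g w else 0) = (\<Sum>s\<in>{s\<in>S - a. s \<in> w}. g w)"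
      using fin by (subst sum.inter_filter) auto
    also have "{s\<in>S - a. s \<in> w} = w - a" using w by auto
    also have "(\<Sum>s\<in>w - a. g w) = of_nat (card w - card a) * g w"
      using w fina by (simp add: card_Diff_subset)
    also have "\<dots> = of_nat (Suc k) * g w"
    proof (cases "card w = r")
      case True
      then have "card w - card a = Suc k" using Suc.prems by simp
      then show ?thesis by simp
    next
      case False
      then show ?thesis using supp w by simp
    qed
    finally show "(\<Sum>s\<in>S - a. if s \<in> w then g w else 0) = of_nat (Suc k) * g w" .
  qed
  finally show ?case by (simp flip: sum_distrib_left del: of_nat_Suc)
qed

text \<open>Inclusion-exclusion, one point of \<open>u\<close> at a time: sets avoiding
  \<open>u\<close> either avoid the next point \<open>s\<close> as well or contain it, and the
  latter case is the claim for \<open>insert s a\<close>. Hence \<open>a\<close> must be general,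
  although the goal is \<open>a = {}\<close>. For empty \<open>u\<close> the left side is 0 or
  \<open>g a\<close>, according to how \<open>card a\<close> compares with \<open>r\<close>.\<close>

lemma primitive_sum_avoiding:
  assumes fin: "finite S" and g: "primitive S r g"
    and "finite u" "u \<subseteq> S" "a \<subseteq> S" "a \<inter> u = {}"
  shows "(\<Sum>w | a \<subseteq> w \<and> w \<subseteq> S - u. g w) = (-1) ^ (r + card a) * (\<Sum>w | a \<subseteq> w \<and> w \<subseteq> a \<union> u. g w)"
  using assms(3-)
proof (induction u arbitrary: a rule: finite_induct)
  case empty
  have supp: "g w = 0" if "w \<subseteq> S" "card w \<noteq> r" for w
    using g that by (auto simp: primitive_def)
  have [simp]: "{w. a \<subseteq> w \<and> w \<subseteq> a} = {a}" by auto
  consider "card a < r" | "card a = r" | "card a > r" by linarith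
  then show ?case
  proof cases
    case 1
    then show ?thesis
      using primitive_sum_supersets[OF fin g empty(2), of "r - card a"] supp[OF empty(2)] by simp
  next
    case 2
    have "(\<Sum>w | a \<subseteq> w \<and> w \<subseteq> S. g w) = (\<Sum>w\<in>{a}. g w)"
    proof (rule sum.mono_neutral_right)
      show "\<forall>w\<in>{w. a \<subseteq> w \<and> w \<subseteq> S} - {a}. g w = 0"
      proof
        fix w assume w: "w \<in> {w. a \<subseteq> w \<and> w \<subseteq> S} - {a}"
        then have "card a < card w"
          using fin by (intro psubset_card_mono) (auto intro: finite_subset)
        then show "g w = 0" using supp w 2 by auto
      qed
    qed (use fin empty in auto)
    then show ?thesis using 2 by simp
  next
    case 3
    have "g w = 0" if "a \<subseteq> w" "w \<subseteq> S" for w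
      using 3 card_mono[OF finite_subset[OF that(2) fin] that(1)] supp[OF that(2)] by simp
    then show ?thesis using empty by (simp add: sum.neutral)
  qed
next
  case (insert s u)
  have sa: "s \<notin> a" "s \<in> S" using insert by auto
  have fina: "finite a" using insert.prems fin finite_subset by blast
  have "{w. a \<subseteq> w \<and> w \<subseteq> S - u}
      = {w. a \<subseteq> w \<and> w \<subseteq> S - insert s u} \<union> {w. insert s a \<subseteq> w \<and> w \<subseteq> S - u}"
    by auto
  moreover have "(\<Sum>w\<in>{w. a \<subseteq> w \<and> w \<subseteq> S - insert s u} \<union> {w. insert s a \<subseteq> w \<and> w \<subseteq> S - u}. g w)
      = (\<Sum>w | a \<subseteq> w \<and> w \<subseteq> S - insert s u. g w) + (\<Sum>w | insert s a \<subseteq> w \<and> w \<subseteq> S - u. g w)"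
    using fin by (intro sum.union_disjoint) (simp_all, blast)
  moreover have "{w. a \<subseteq> w \<and> w \<subseteq> a \<union> insert s u}
      = {w. a \<subseteq> w \<and> w \<subseteq> a \<union> u} \<union> {w. insert s a \<subseteq> w \<and> w \<subseteq> insert s a \<union> u}"
    by auto
  moreover have "(\<Sum>w\<in>{w. a \<subseteq> w \<and> w \<subseteq> a \<union> u} \<union> {w. insert s a \<subseteq> w \<and> w \<subseteq> insert s a \<union> u}. g w)
      = (\<Sum>w | a \<subseteq> w \<and> w \<subseteq> a \<union> u. g w) + (\<Sum>w | insert s a \<subseteq> w \<and> w \<subseteq> insert s a \<union> u. g w)"
    using insert.hyps fina sa by (intro sum.union_disjoint finite_Collect_conjI disjI2) (simp_all, blast)
  moreover note insert.IH[of a] insert.IH[of "insert s a"]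
  ultimately show ?case
    using insert.prems insert.hyps sa fina by (simp add: algebra_simps)
qed

lemma subset_sum_complement:
  assumes "finite S" "primitive S r g" "u \<subseteq> S"
  shows "subset_sum g (S - u) = (-1) ^ r * subset_sum g u"
  using primitive_sum_avoiding[OF assms(1,2) finite_subset[OF assms(3,1)] assms(3), of "{}"]
  by (simp add: subset_sum_def Pow_def)

section \<open>Inner products of ladder functions on a level\<close>

definition level :: "'a set \<Rightarrow> nat \<Rightarrow> 'a set set" where
  "level S k = {u. u \<subseteq> S \<and> card u = k}"

definition level_inner :: "'a set \<Rightarrow> nat \<Rightarrow> ('a set \<Rightarrow> complex) \<Rightarrow> ('a set \<Rightarrow> complex) \<Rightarrow> complex" where
  "level_inner S k F G = (\<Sum>u\<in>level S k. cnj (F u) * G u)"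

lemma finite_level [simp]: "finite S \<Longrightarrow> finite (level S k)"
  by (auto simp: level_def)

text \<open>Both sides run over the covering pairs between the levels \<open>k\<close> and
  \<open>k + 1\<close>; this makes raising and lowering adjoint to each other.\<close>

lemma sum_level_Suc:
  assumes "finite S"
  shows "(\<Sum>u\<in>level S (Suc k). \<Sum>s\<in>u. h (u - {s}) u) = (\<Sum>u\<in>level S k. \<Sum>s\<in>S - u. (h u (insert s u) :: complex))"
proof -
  have fin: "finite u" if "u \<subseteq> S" for u
    using assms that finite_subset by blast
  have "(\<Sum>u\<in>level S (Suc k). \<Sum>s\<in>u. h (u - {s}) u)
      = (\<Sum>(u, s)\<in>Sigma (level S (Suc k)) (\<lambda>u. u). h (u - {s}) u)"
    using assms fin by (subst sum.Sigma) (auto simp: level_def)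
  also have "\<dots> = (\<Sum>(u, s)\<in>Sigma (level S k) (\<lambda>u. S - u). h u (insert s u))"
    by (rule sum.reindex_bij_witness[where i = "\<lambda>(v, s). (insert s v, s)" and j = "\<lambda>(w, s). (w - {s}, s)"])
      (auto simp: insert_absorb level_def fin)
  also have "\<dots> = (\<Sum>u\<in>level S k. \<Sum>s\<in>S - u. h u (insert s u))"
    using assms by (subst sum.Sigma) auto
  finally show ?thesis .
qed

text \<open>Write \<open>F\<close> at level \<open>k + 1\<close> through its deletions, move the
  lowering across as a raising of \<open>G\<close>, and use the eigenvalue of
  \<open>G\<close>.\<close>

lemma level_inner_Suc:
  assumes fin: "finite S" and F: "ladder S r F" and G: "ladder S r' G"
  shows "(of_nat (Suc k) - of_nat r) * level_inner S (Suc k) F G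
       = (of_nat (card S) - of_nat k - of_nat r') * level_inner S k F G"
    and "(of_nat (Suc k) - of_nat r') * level_inner S (Suc k) F G
       = (of_nat (card S) - of_nat k - of_nat r) * level_inner S k F G"
proof -
  have *: "(of_nat (Suc k) - of_nat r) * level_inner S (Suc k) F G
       = (of_nat (card S) - of_nat k - of_nat r') * level_inner S k F G"
    if F: "ladder S r F" and G: "ladder S r' G" for r r' F and G :: "'a set \<Rightarrow> complex"
  proof -
    have "(of_nat (Suc k) - of_nat r) * level_inner S (Suc k) F G
        = (\<Sum>u\<in>level S (Suc k). cnj (\<Sum>s\<in>u. F (u - {s})) * G u)"
      unfolding level_inner_def sum_distrib_left
      by (rule sum.cong[OF refl]) (use F in \<open>auto simp: ladder_def level_def\<close>)
    also have "\<dots> = (\<Sum>u\<in>level S (Suc k). \<Sum>s\<in>u. cnj (F (u - {s})) * G u)"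
      by (simp add: sum_distrib_right)
    also have "\<dots> = (\<Sum>u\<in>level S k. \<Sum>s\<in>S - u. cnj (F u) * G (insert s u))"
      by (rule sum_level_Suc[OF fin])
    also have "\<dots> = (of_nat (card S) - of_nat k - of_nat r') * level_inner S k F G"
      unfolding level_inner_def sum_distrib_left[of "of_nat _ - of_nat _ - of_nat _"]
      by (rule sum.cong[OF refl])
        (use G in \<open>auto simp: ladder_def level_def simp flip: sum_distrib_left\<close>)
    finally show ?thesis .
  qed
  show "(of_nat (Suc k) - of_nat r) * level_inner S (Suc k) F G
       = (of_nat (card S) - of_nat k - of_nat r') * level_inner S k F G"
    by (rule *[OF F G])
  \<comment> \<open>The second identity is the first with \<open>F\<close> and \<open>G\<close>
    exchanged and then conjugated; its coefficients are real.\<close>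
  have cnj_inner: "level_inner S j F G = cnj (level_inner S j G F)" for j
    by (simp add: level_inner_def mult.commute)
  have "cnj ((of_nat (Suc k) - of_nat r') * level_inner S (Suc k) G F)
       = cnj ((of_nat (card S) - of_nat k - of_nat r) * level_inner S k G F)"
    by (simp only: *[OF G F])
  then show "(of_nat (Suc k) - of_nat r') * level_inner S (Suc k) F G
       = (of_nat (card S) - of_nat k - of_nat r) * level_inner S k F G"
    by (simp add: cnj_inner)
qed

text \<open>If the inner product vanishes at level \<open>k\<close>, both recurrences have right
  side 0; their difference is \<open>r' - r\<close> times the inner product at level
  \<open>k + 1\<close>.\<close>

lemma level_inner_orthogonal:
  assumes fin: "finite S" and F: "ladder S r F" and G: "ladder S r' G" and "r \<noteq> r'"
  shows "level_inner S k F G = 0"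
proof (induction k)
  case 0
  have "level S 0 = {{}}"
    using fin by (auto simp: level_def finite_subset)
  moreover have "F {} = 0 \<or> G {} = 0"
    using F G \<open>r \<noteq> r'\<close> unfolding ladder_def
    by (metis card.empty empty_subsetI gr0I)
  ultimately show ?case by (auto simp: level_inner_def)
next
  case (Suc k)
  have "(of_nat (Suc k) - of_nat r) * level_inner S (Suc k) F G = 0"
    "(of_nat (Suc k) - of_nat r') * level_inner S (Suc k) F G = 0"
    using level_inner_Suc[OF fin F G, of k] Suc by simp_all
  then have "(of_nat r' - of_nat r) * level_inner S (Suc k) F G = 0"
    by (auto simp: algebra_simps)
  then show ?case using \<open>r \<noteq> r'\<close> by simp
qed

text \<open>With \<open>n = card S - 2 * r\<close> the recurrence reads
  \<open>(k + 1) * I (k + 1) = (n - k) * I k\<close>, which is the recurrence of the binomial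
  coefficients \<open>n choose k\<close>.\<close>

lemma level_inner_binomial:
  assumes fin: "finite S" and F: "ladder S r F" and G: "ladder S r G" and "2 * r \<le> card S"
  shows "level_inner S (r + k) F G = of_nat ((card S - 2 * r) choose k) * level_inner S r F G"
proof (induction k)
  case 0
  then show ?case by simp
next
  case (Suc k)
  define n where "n = card S - 2 * r"
  have n: "(of_nat (card S) :: complex) = of_nat n + 2 * of_nat r"
    using assms(4) by (simp add: n_def of_nat_diff)
  have "of_nat (Suc k) * level_inner S (r + Suc k) F G = (of_nat n - of_nat k) * level_inner S (r + k) F G"
    using level_inner_Suc(1)[OF fin F G, of "r + k"] n by (simp add: algebra_simps)
  also have "\<dots> = (of_nat n - of_nat k) * of_nat (n choose k) * level_inner S r F G"
    using Suc by (simp add: n_def)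
  also have "(of_nat n - of_nat k) * of_nat (n choose k) = (of_nat (Suc k) * of_nat (n choose Suc k) :: complex)"
  proof (cases "k \<le> n")
    case True
    have "of_nat ((n - k) * (n choose k)) = (of_nat (Suc k * (n choose Suc k)) :: complex)"
      by (simp only: binomial_absorb_comp binomial_absorption)
    then show ?thesis using True by (simp only: of_nat_diff of_nat_mult)
  qed (simp add: binomial_eq_0)
  finally have "of_nat (Suc k) * level_inner S (r + Suc k) F G
      = of_nat (Suc k) * (of_nat (n choose Suc k) * level_inner S r F G)"
    by (simp only: mult.assoc)
  then show ?case unfolding n_def by (simp only: mult_cancel_left of_nat_eq_0_iff) simp
qed

section \<open>Orthonormal bases and block-diagonal algebras\<close>

lemma sum_fun_apply: "(\<Sum>a\<in>t. f a) x = (\<Sum>a\<in>t. f a x)"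
  by (induction t rule: infinite_finite_induct) auto

lemma cvectors_subset_span:
  assumes "finite K"
  shows "cvectors K \<subseteq> cvec.span ((\<lambda>x y. if y = x then 1 else 0) ` K)"
proof
  fix w :: "'a \<Rightarrow> complex" assume w: "w \<in> cvectors K"
  have "w = (\<Sum>x\<in>K. cscale (w x) (\<lambda>y. if y = x then 1 else 0))"
  proof
    fix y
    show "w y = (\<Sum>x\<in>K. cscale (w x) (\<lambda>y. if y = x then 1 else 0)) y"
      using w assms by (auto simp: sum_fun_apply cscale_def cvectors_def if_distrib cong: if_cong)
  qed
  also have "\<dots> \<in> cvec.span ((\<lambda>x y. if y = x then 1 else 0) ` K)"
    by (intro cvec.span_sum cvec.span_scale cvec.span_base imageI)
  finally show "w \<in> cvec.span ((\<lambda>x y. if y = x then 1 else 0) ` K)" .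
qed

lemma cinner_on_sum_right:
  "cinner_on K w (\<Sum>a\<in>t. cscale (c a) (v a)) = (\<Sum>a\<in>t. c a * cinner_on K w (v a))"
proof -
  have "cinner_on K w (\<Sum>a\<in>t. cscale (c a) (v a)) = (\<Sum>x\<in>K. \<Sum>a\<in>t. c a * (cnj (w x) * v a x))"
    by (simp add: cinner_on_def sum_fun_apply cscale_def sum_distrib_left mult_ac)
  also have "\<dots> = (\<Sum>a\<in>t. \<Sum>x\<in>K. c a * (cnj (w x) * v a x))"
    by (rule sum.swap)
  finally show ?thesis by (simp add: cinner_on_def sum_distrib_left)
qed

lemma independent_finite_cvectors:
  assumes "finite K" "cvec.independent W" "W \<subseteq> cvectors K"
  shows "finite W"
  using cvec.independent_span_bound[OF _ assms(2), of "(\<lambda>x y. if y = x then 1 else 0) ` K"]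
    cvectors_subset_span[OF assms(1)] assms by auto

lemma subspace_cvectors: "cvec.subspace (cvectors K)"
  by (auto simp: cvec.subspace_def cvectors_def cscale_def)

text \<open>Spanning follows from completeness: a vector minus its projection is orthogonal to every
  \<open>v a\<close>, hence 0.\<close>

lemma orthonormal_basis_onI:
  assumes fin: "finite K" and v: "\<And>a. a \<in> I \<Longrightarrow> v a \<in> cvectors K"
    and orth: "\<And>a b. a \<in> I \<Longrightarrow> b \<in> I \<Longrightarrow> cinner_on K (v a) (v b) = (if a = b then 1 else 0)"
    and complete: "\<And>w. w \<in> cvectors K \<Longrightarrow> (\<And>a. a \<in> I \<Longrightarrow> cinner_on K (v a) w = 0) \<Longrightarrow> w = 0"
  shows "orthonormal_basis_on K I v (cvectors K)"
proof -
  have inj: "inj_on v I"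
    using orth by (intro inj_onI) (metis zero_neq_one)
  have ind: "cvec.independent (v ` I)"
    unfolding cvec.dependent_explicit
  proof clarify
    fix t c w
    assume t: "finite t" "t \<subseteq> v ` I" "(\<Sum>w\<in>t. cscale (c w) w) = 0" and w: "w \<in> t" "c w \<noteq> 0"
    have "cinner_on K w w' = (if w' = w then 1 else 0)" if w': "w' \<in> t" for w'
    proof -
      obtain a b where "a \<in> I" "w = v a" "b \<in> I" "w' = v b" using w' w t(2) by blast
      then show ?thesis using orth[of a b] inj by (auto simp: inj_on_eq_iff)
    qed
    then have "(\<Sum>w'\<in>t. c w' * cinner_on K w w') = (\<Sum>w'\<in>t. if w' = w then c w else 0)"
      by (intro sum.cong) auto
    then have "(\<Sum>w'\<in>t. c w' * cinner_on K w w') = c w"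
      using t w by simp
    moreover have "cinner_on K w 0 = 0" by (simp add: cinner_on_def)
    ultimately show False
      using cinner_on_sum_right[of K w c "\<lambda>w. w" t] t w by simp
  qed
  \<comment> \<open>Finiteness of \<open>I\<close> makes the projection \<open>w'\<close> a genuine
    sum; a sum over an infinite set would be 0 by default.\<close>
  have finI: "finite I"
    using independent_finite_cvectors[OF fin ind] v inj by (auto dest: finite_imageD)
  have "w \<in> cvec.span (v ` I)" if w: "w \<in> cvectors K" for w
  proof -
    define w' where "w' = (\<Sum>a\<in>I. cscale (cinner_on K (v a) w) (v a))"
    have "w' \<in> cvec.span (v ` I)"
      unfolding w'_def by (intro cvec.span_sum cvec.span_scale cvec.span_base imageI)
    moreover have "w' \<in> cvectors K"
      unfolding w'_def
      by (intro cvec.subspace_sum cvec.subspace_scale subspace_cvectors v)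
    moreover have "cinner_on K (v a) (w - w') = 0" if a: "a \<in> I" for a
    proof -
      have "cinner_on K (v a) w' = (\<Sum>b\<in>I. cinner_on K (v b) w * (if a = b then 1 else 0))"
        unfolding w'_def cinner_on_sum_right using orth a by simp
      also have "\<dots> = cinner_on K (v a) w"
        using a finI by (simp add: if_distrib cong: if_cong)
      finally show ?thesis
        by (simp add: cinner_on_def right_diff_distrib sum_subtractf)
    qed
    ultimately have "w - w' = 0"
      using complete[of "w - w'"] w subspace_cvectors[of K] cvec.subspace_diff by blast
    then show ?thesis using \<open>w' \<in> cvec.span (v ` I)\<close> by simp
  qed
  moreover have "cvec.span (v ` I) \<subseteq> cvectors K"
    by (intro cvec.span_minimal subspace_cvectors) (use v in auto)
  ultimately show ?thesis
    using orth ind by (auto simp: orthonormal_basis_on_def)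
qed

section \<open>Matrix algebras acting blockwise on an orthonormal basis\<close>

lemma mat_vec_mat_mul: "finite K \<Longrightarrow> mat_vec K (mat_mul K P Q) v = mat_vec K P (mat_vec K Q v)"
proof
  fix x
  have "mat_vec K (mat_mul K P Q) v x = (\<Sum>y\<in>K. \<Sum>z\<in>K. P x z * Q z y * v y)"
    by (simp add: mat_vec_def mat_mul_def sum_distrib_right)
  also have "\<dots> = (\<Sum>z\<in>K. \<Sum>y\<in>K. P x z * Q z y * v y)"
    by (rule sum.swap)
  finally show "mat_vec K (mat_mul K P Q) v x = mat_vec K P (mat_vec K Q v) x"
    by (simp add: mat_vec_def sum_distrib_left mult.assoc)
qed

lemma mat_subalgebra_mat_space: "mat_subalgebra K (mat_space K)"
  by (auto simp: mat_subalgebra_def mat_space_def mat_one_def mat_mul_def mat_scale_def)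

lemma mat_subalgebra_generated:
  assumes "G \<subseteq> mat_space K"
  shows "mat_subalgebra K (generated_subalgebra K G)"
  unfolding mat_subalgebra_def
proof (intro conjI)
  show "generated_subalgebra K G \<subseteq> mat_space K"
    using assms mat_subalgebra_mat_space by (auto simp: generated_subalgebra_def)
qed (auto simp: generated_subalgebra_def mat_subalgebra_def)

lemma generated_subalgebra_minimal:
  "mat_subalgebra K \<A> \<Longrightarrow> G \<subseteq> \<A> \<Longrightarrow> generated_subalgebra K G \<subseteq> \<A>"
  by (auto simp: generated_subalgebra_def)

text \<open>The products carry no conjugation because the goal concerns the transpose of
  \<open>U\<^sub>1\<close>; the columns will be real. Nonemptiness of \<open>B r\<close> guarantees
  that block \<open>r\<close> is visible in the action.\<close>

locale block_basis =
  fixes K :: "'k set" and D :: nat and N :: "nat \<Rightarrow> nat set" and B :: "nat \<Rightarrow> 'b set"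
    and u :: "nat \<Rightarrow> 'b \<Rightarrow> nat \<Rightarrow> 'k \<Rightarrow> complex"
  assumes finite_K: "finite K" and finite_N: "\<And>r. finite (N r)"
    and B_nonempty: "\<And>r. r \<le> D \<Longrightarrow> B r \<noteq> {}"
    and u_cvectors: "\<And>r \<xi> i. r \<le> D \<Longrightarrow> \<xi> \<in> B r \<Longrightarrow> i \<in> N r \<Longrightarrow> u r \<xi> i \<in> cvectors K"
    and u_inner: "\<And>r \<xi> i r' \<xi>' i'. \<lbrakk>r \<le> D; \<xi> \<in> B r; i \<in> N r; r' \<le> D; \<xi>' \<in> B r'; i' \<in> N r'\<rbrakk> \<Longrightarrow>
      (\<Sum>x\<in>K. u r \<xi> i x * u r' \<xi>' i' x) = (if (r, \<xi>, i) = (r', \<xi>', i') then 1 else 0)"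
    and u_complete: "\<And>w. \<lbrakk>w \<in> cvectors K;
      \<And>r \<xi> i. \<lbrakk>r \<le> D; \<xi> \<in> B r; i \<in> N r\<rbrakk> \<Longrightarrow> (\<Sum>x\<in>K. u r \<xi> i x * w x) = 0\<rbrakk> \<Longrightarrow> w = 0"
begin

text \<open>The coefficients do not depend on \<xi>, which is why equal blocks repeat. This is a
  relation because \<open>F\<close> is determined only at indices in \<open>N r\<close> with
  \<open>r \<le> D\<close>.\<close>

definition acts :: "('k \<Rightarrow> 'k \<Rightarrow> complex) \<Rightarrow> (nat \<Rightarrow> nat \<Rightarrow> nat \<Rightarrow> complex) \<Rightarrow> bool" where
  "acts M F \<longleftrightarrow> M \<in> mat_space K \<and>
     (\<forall>r\<le>D. \<forall>\<xi>\<in>B r. \<forall>j\<in>N r. \<forall>x. mat_vec K M (u r \<xi> j) x = (\<Sum>i\<in>N r. F r i j * u r \<xi> i x))"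

lemma acts_vec:
  "acts M F \<Longrightarrow> r \<le> D \<Longrightarrow> \<xi> \<in> B r \<Longrightarrow> j \<in> N r \<Longrightarrow>
     mat_vec K M (u r \<xi> j) x = (\<Sum>i\<in>N r. F r i j * u r \<xi> i x)"
  by (auto simp: acts_def)

lemma acts_cong:
  assumes "acts M F" "\<And>r i j. r \<le> D \<Longrightarrow> i \<in> N r \<Longrightarrow> j \<in> N r \<Longrightarrow> F r i j = G r i j"
  shows "acts M G"
  using assms unfolding acts_def by auto

lemma acts_one: "acts (mat_one K) (\<lambda>r i j. if i = j then 1 else 0)"
  unfolding acts_def
proof (intro conjI allI impI ballI)
  fix r \<xi> j x assume *: "r \<le> D" "\<xi> \<in> B r" "j \<in> N r"
  have "mat_vec K (mat_one K) (u r \<xi> j) x = (\<Sum>y\<in>K. if x = y then u r \<xi> j y else 0)"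
    unfolding mat_vec_def mat_one_def by (rule sum.cong) auto
  also have "\<dots> = u r \<xi> j x"
    using finite_K u_cvectors[OF *] by (auto simp: cvectors_def)
  also have "\<dots> = (\<Sum>i\<in>N r. (if i = j then 1 else 0) * u r \<xi> i x)"
    using finite_N[of r] * by (simp add: if_distrib[of "\<lambda>c. c * _"] cong: if_cong)
  finally show "mat_vec K (mat_one K) (u r \<xi> j) x = (\<Sum>i\<in>N r. (if i = j then 1 else 0) * u r \<xi> i x)" .
qed (auto simp: mat_space_def mat_one_def)

lemma acts_add: "acts P F \<Longrightarrow> acts Q G \<Longrightarrow> acts (P + Q) (\<lambda>r i j. F r i j + G r i j)"
  by (auto simp: acts_def mat_space_def mat_vec_def distrib_right sum.distrib)

lemma acts_scale: "acts P F \<Longrightarrow> acts (mat_scale c P) (\<lambda>r i j. c * F r i j)"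
  by (auto simp: acts_def mat_space_def mat_vec_def mat_scale_def mult.assoc simp flip: sum_distrib_left)

lemma acts_mul:
  assumes "acts P F" "acts Q G"
  shows "acts (mat_mul K P Q) (\<lambda>r i j. \<Sum>k\<in>N r. F r i k * G r k j)"
  unfolding acts_def
proof (intro conjI allI impI ballI)
  show "mat_mul K P Q \<in> mat_space K"
    using assms by (auto simp: acts_def mat_space_def mat_mul_def)
  fix r \<xi> j x assume *: "r \<le> D" "\<xi> \<in> B r" "j \<in> N r"
  have "mat_vec K Q (u r \<xi> j) = (\<lambda>x. \<Sum>k\<in>N r. G r k j * u r \<xi> k x)"
    using acts_vec[OF assms(2) *] by blast
  then have "mat_vec K (mat_mul K P Q) (u r \<xi> j) x
      = (\<Sum>y\<in>K. \<Sum>k\<in>N r. G r k j * (P x y * u r \<xi> k y))"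
    by (simp add: mat_vec_mat_mul finite_K mat_vec_def[of K P] sum_distrib_left mult_ac)
  also have "\<dots> = (\<Sum>k\<in>N r. \<Sum>y\<in>K. G r k j * (P x y * u r \<xi> k y))"
    by (rule sum.swap)
  also have "\<dots> = (\<Sum>k\<in>N r. G r k j * mat_vec K P (u r \<xi> k) x)"
    by (simp add: mat_vec_def sum_distrib_left)
  also have "\<dots> = (\<Sum>k\<in>N r. \<Sum>i\<in>N r. F r i k * G r k j * u r \<xi> i x)"
    using acts_vec[OF assms(1) *(1,2)] by (simp add: sum_distrib_left mult_ac)
  also have "\<dots> = (\<Sum>i\<in>N r. \<Sum>k\<in>N r. F r i k * G r k j * u r \<xi> i x)"
    by (rule sum.swap)
  finally show "mat_vec K (mat_mul K P Q) (u r \<xi> j) x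
      = (\<Sum>i\<in>N r. (\<Sum>k\<in>N r. F r i k * G r k j) * u r \<xi> i x)"
    by (simp add: sum_distrib_right)
qed

definition block_algebra :: "('k \<Rightarrow> 'k \<Rightarrow> complex) set" where
  "block_algebra = {M. \<exists>F. acts M F}"

lemma mat_subalgebra_block_algebra: "mat_subalgebra K block_algebra"
  unfolding mat_subalgebra_def block_algebra_def
proof (intro conjI ballI allI)
  show "{M. \<exists>F. acts M F} \<subseteq> mat_space K" by (auto simp: acts_def)
qed (use acts_one acts_add acts_mul acts_scale in blast)+

text \<open>The left side is an entry of the conjugated matrix; orthonormality picks out a single
  coefficient, so \<open>F r\<close> is the block and everything off the blocks is 0.\<close>

lemma acts_entry:
  assumes "acts M F" "r \<le> D" "\<xi> \<in> B r" "i \<in> N r" "r' \<le> D" "\<xi>' \<in> B r'" "j \<in> N r'"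
  shows "(\<Sum>x\<in>K. u r \<xi> i x * mat_vec K M (u r' \<xi>' j) x) = (if (r, \<xi>) = (r', \<xi>') then F r i j else 0)"
proof -
  have "(\<Sum>x\<in>K. u r \<xi> i x * mat_vec K M (u r' \<xi>' j) x)
      = (\<Sum>x\<in>K. \<Sum>k\<in>N r'. F r' k j * (u r \<xi> i x * u r' \<xi>' k x))"
    by (simp add: acts_vec[OF assms(1,5-)] sum_distrib_left mult_ac)
  also have "\<dots> = (\<Sum>k\<in>N r'. \<Sum>x\<in>K. F r' k j * (u r \<xi> i x * u r' \<xi>' k x))"
    by (rule sum.swap)
  also have "\<dots> = (\<Sum>k\<in>N r'. F r' k j * (if (r, \<xi>, i) = (r', \<xi>', k) then 1 else 0))"
    unfolding sum_distrib_left[symmetric] by (rule sum.cong[OF refl]) (simp add: u_inner assms)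
  also have "\<dots> = (if (r, \<xi>) = (r', \<xi>') then F r i j else 0)"
    using finite_N[of r'] assms by (auto simp: if_distrib cong: if_cong)
  finally show ?thesis .
qed

text \<open>Any one \<xi> in \<open>B r\<close> suffices to read off the block as entries.\<close>

lemma acts_unique_coeff:
  assumes "acts M F" "acts M G" "r \<le> D" "i \<in> N r" "j \<in> N r"
  shows "F r i j = G r i j"
proof -
  obtain \<xi> where "\<xi> \<in> B r" using B_nonempty assms(3) by blast
  then show ?thesis
    using acts_entry[OF assms(1), of r \<xi> i r \<xi> j] acts_entry[OF assms(2), of r \<xi> i r \<xi> j] assms by simp
qed

text \<open>Every row of \<open>P - Q\<close> is orthogonal to all columns, hence 0 by
  completeness.\<close>

lemma acts_unique_mat:
  assumes P: "acts P F" and Q: "acts Q F"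
  shows "P = Q"
proof (intro ext)
  fix x y
  define w where "w = (\<lambda>y. P x y - Q x y)"
  have "(\<Sum>y\<in>K. u r \<xi> i y * w y) = 0" if "r \<le> D" "\<xi> \<in> B r" "i \<in> N r" for r \<xi> i
  proof -
    have "(\<Sum>y\<in>K. u r \<xi> i y * w y) = mat_vec K P (u r \<xi> i) x - mat_vec K Q (u r \<xi> i) x"
      by (simp add: w_def mat_vec_def algebra_simps sum_subtractf)
    then show ?thesis using acts_vec[OF P that] acts_vec[OF Q that] by simp
  qed
  moreover have "w \<in> cvectors K"
    using P Q by (auto simp: w_def acts_def mat_space_def cvectors_def)
  ultimately have "w = 0" using u_complete by blast
  then show "P x y = Q x y" by (metis eq_iff_diff_eq_0 w_def zero_fun_apply)
qed

end

section \<open>Matrix units in a subalgebra of the block algebra\<close>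

definition unit_block :: "nat \<Rightarrow> nat \<Rightarrow> nat \<Rightarrow> nat \<Rightarrow> nat \<Rightarrow> nat \<Rightarrow> complex" where
  "unit_block s i j = (\<lambda>r a b. if r = s \<and> a = i \<and> b = j then 1 else 0)"

locale block_subalgebra = block_basis K D N B u
  for K :: "'k set" and D N and B :: "nat \<Rightarrow> 'b set" and u +
  fixes T :: "('k \<Rightarrow> 'k \<Rightarrow> complex) set"
  assumes T_subalgebra: "mat_subalgebra K T" and T_block: "T \<subseteq> block_algebra"
begin

definition realizable :: "(nat \<Rightarrow> nat \<Rightarrow> nat \<Rightarrow> complex) \<Rightarrow> bool" where
  "realizable F \<longleftrightarrow> (\<exists>M\<in>T. acts M F)"

lemma realizable_cong:
  "realizable F \<Longrightarrow> (\<And>r i j. r \<le> D \<Longrightarrow> i \<in> N r \<Longrightarrow> j \<in> N r \<Longrightarrow> F r i j = G r i j) \<Longrightarrow> realizable G"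
  unfolding realizable_def using acts_cong by blast

lemma realizable_add: "realizable F \<Longrightarrow> realizable G \<Longrightarrow> realizable (\<lambda>r i j. F r i j + G r i j)"
  unfolding realizable_def using acts_add T_subalgebra unfolding mat_subalgebra_def by blast

lemma realizable_scale: "realizable F \<Longrightarrow> realizable (\<lambda>r i j. c * F r i j)"
  unfolding realizable_def using acts_scale T_subalgebra unfolding mat_subalgebra_def by blast

lemma realizable_mul:
  "realizable F \<Longrightarrow> realizable G \<Longrightarrow> realizable (\<lambda>r i j. \<Sum>k\<in>N r. F r i k * G r k j)"
  unfolding realizable_def using acts_mul T_subalgebra unfolding mat_subalgebra_def by blast

lemma realizable_one: "realizable (\<lambda>r i j. if i = j then 1 else 0)"
  unfolding realizable_def using acts_one T_subalgebra unfolding mat_subalgebra_def by blast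

lemma realizable_sum:
  "finite A \<Longrightarrow> (\<And>a. a \<in> A \<Longrightarrow> realizable (F a)) \<Longrightarrow> realizable (\<lambda>r i j. \<Sum>a\<in>A. F a r i j)"
proof (induction A rule: finite_induct)
  case empty
  then show ?case using realizable_scale[OF realizable_one, of 0] by simp
next
  case (insert a A)
  then show ?case using realizable_add[of "F a" "\<lambda>r i j. \<Sum>a\<in>A. F a r i j"] by simp
qed

lemma realizable_block_sum:
  assumes units: "\<And>r i j. r \<le> D \<Longrightarrow> i \<in> N r \<Longrightarrow> j \<in> N r \<Longrightarrow> realizable (unit_block r i j)"
  shows "realizable G"
proof -
  have "realizable (\<lambda>r a b. \<Sum>s\<le>D. \<Sum>i\<in>N s. \<Sum>j\<in>N s. G s i j * unit_block s i j r a b)"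
    by (intro realizable_sum realizable_scale units finite_N) auto
  then show ?thesis
  proof (rule realizable_cong)
    fix r a b assume *: "r \<le> D" "a \<in> N r" "b \<in> N r"
    have "(\<Sum>s\<le>D. \<Sum>i\<in>N s. \<Sum>j\<in>N s. G s i j * unit_block s i j r a b)
        = (\<Sum>s\<le>D. if s = r then \<Sum>i\<in>N r. if i = a then \<Sum>j\<in>N r. if j = b then G r a b else 0 else 0 else 0)"
      by (intro sum.cong refl) (auto simp: unit_block_def intro!: sum.cong)
    also have "\<dots> = G r a b" using * finite_N[of r] by simp
    finally show "(\<Sum>s\<le>D. \<Sum>i\<in>N s. \<Sum>j\<in>N s. G s i j * unit_block s i j r a b) = G r a b" .
  qed
qed

text \<open>The isomorphism sends a matrix to its blocks. It is injective because the blocks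
  determine the matrix, and surjective because the matrix units span all families of blocks.\<close>

lemma iso_to_block_sum_if_units:
  assumes units: "\<And>r i j. r \<le> D \<Longrightarrow> i \<in> N r \<Longrightarrow> j \<in> N r \<Longrightarrow> realizable (unit_block r i j)"
  shows "iso_to_block_sum K T D N"
proof -
  define coeff where "coeff M = (SOME F. acts M F)" for M
  have coeff: "acts M (coeff M)" if "M \<in> T" for M
    using that T_block someI_ex[of "acts M"] by (auto simp: coeff_def block_algebra_def)
  \<comment> \<open>Cutting the chosen coefficients to 0 outside the index sets gives the unique
    representative in \<open>block_sum D N\<close>, so each homomorphism law reduces to the matching
    closure rule of \<open>acts\<close>.\<close>
  define \<phi> where "\<phi> M = (\<lambda>r i j. if r \<le> D \<and> i \<in> N r \<and> j \<in> N r then coeff M r i j else 0)" for M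
  have acts_\<phi>: "acts M (\<phi> M)" if "M \<in> T" for M
    by (rule acts_cong[OF coeff[OF that]]) (simp add: \<phi>_def)
  have \<phi>_eq: "\<phi> M = F" if "M \<in> T" "acts M F" "F \<in> block_sum D N" for M F
  proof (intro ext)
    fix r i j
    show "\<phi> M r i j = F r i j"
      using acts_unique_coeff[OF coeff[OF that(1)] that(2), of r i j] that(3)
      by (cases "r \<le> D") (auto simp: \<phi>_def block_sum_def mat_space_def)
  qed
  have \<phi>_block: "\<phi> M \<in> block_sum D N" for M
    by (auto simp: \<phi>_def block_sum_def mat_space_def fun_eq_iff)
  have closed: "mat_one K \<in> T" "\<And>P Q. P \<in> T \<Longrightarrow> Q \<in> T \<Longrightarrow> P + Q \<in> T"
    "\<And>P Q. P \<in> T \<Longrightarrow> Q \<in> T \<Longrightarrow> mat_mul K P Q \<in> T" "\<And>c P. P \<in> T \<Longrightarrow> mat_scale c P \<in> T"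
    using T_subalgebra by (auto simp: mat_subalgebra_def)
  show ?thesis
    unfolding iso_to_block_sum_def
  proof (intro exI[of _ \<phi>] conjI ballI allI)
    show "bij_betw \<phi> T (block_sum D N)"
      unfolding bij_betw_def
    proof
      show "inj_on \<phi> T"
        by (rule inj_onI) (metis acts_\<phi> acts_unique_mat)
      show "\<phi> ` T = block_sum D N"
        using \<phi>_block \<phi>_eq realizable_block_sum[OF units] unfolding realizable_def by blast
    qed
    show "\<phi> (mat_one K) = block_one D N"
      by (rule \<phi>_eq[OF closed(1)], rule acts_cong[OF acts_one])
        (auto simp: block_one_def mat_one_def block_sum_def mat_space_def)
    fix P Q c assume P: "P \<in> T"
    show "\<phi> (mat_scale c P) = (\<lambda>r. mat_scale c (\<phi> P r))"
      by (rule \<phi>_eq[OF closed(4)[OF P]], rule acts_cong[OF acts_scale[OF acts_\<phi>[OF P]]])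
        (use \<phi>_block[of P] in \<open>auto simp: mat_scale_def block_sum_def mat_space_def fun_eq_iff\<close>)
    assume Q: "Q \<in> T"
    show "\<phi> (P + Q) = \<phi> P + \<phi> Q"
      by (rule \<phi>_eq[OF closed(2)[OF P Q]], rule acts_cong[OF acts_add[OF acts_\<phi>[OF P] acts_\<phi>[OF Q]]])
        (use \<phi>_block[of P] \<phi>_block[of Q] in \<open>auto simp: block_sum_def mat_space_def fun_eq_iff\<close>)
    show "\<phi> (mat_mul K P Q) = (\<lambda>r. mat_mul (N r) (\<phi> P r) (\<phi> Q r))"
      by (rule \<phi>_eq[OF closed(3)[OF P Q]], rule acts_cong[OF acts_mul[OF acts_\<phi>[OF P] acts_\<phi>[OF Q]]])
        (use \<phi>_block[of P] \<phi>_block[of Q] in \<open>auto simp: mat_mul_def block_sum_def mat_space_def fun_eq_iff\<close>)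
  qed
qed

text \<open>The product passes through the index \<open>k\<close>, so it is 0 on every block that
  lacks \<open>k\<close>; this is the source of triangularity.\<close>

lemma realizable_mul_entry:
  assumes "realizable (\<lambda>r a b. if a = i \<and> b = k then \<rho> r else 0)"
    and "realizable (\<lambda>r a b. if a = k \<and> b = j then \<sigma> r else 0)"
  shows "realizable (\<lambda>r a b. if a = i \<and> b = j then (if k \<in> N r then \<rho> r * \<sigma> r else 0) else 0)"
proof (rule realizable_cong[OF realizable_mul[OF assms]])
  fix r a b
  have "(\<Sum>k'\<in>N r. (if a = i \<and> k' = k then \<rho> r else 0) * (if k' = k \<and> b = j then \<sigma> r else 0))
      = (\<Sum>k'\<in>N r. if k' = k then (if a = i \<and> b = j then \<rho> r * \<sigma> r else 0) else 0)"
    by (rule sum.cong) auto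
  then show "(\<Sum>k'\<in>N r. (if a = i \<and> k' = k then \<rho> r else 0) * (if k' = k \<and> b = j then \<sigma> r else 0))
      = (if a = i \<and> b = j then (if k \<in> N r then \<rho> r * \<sigma> r else 0) else 0)"
    using finite_N[of r] by simp
qed

text \<open>Go from \<open>j\<close> down to \<open>s\<close> and up to \<open>i\<close>. The
  product is a multiple of the \<open>(i, j)\<close> unit on each block, nonzero on block
  \<open>s\<close> and 0 on blocks \<open>r > s\<close>, which lack the index \<open>s\<close>.
  Strong induction on \<open>s\<close> removes the blocks \<open>r < s\<close>.\<close>

lemma realizable_units:
  assumes N: "\<And>r. N r \<subseteq> {r..D}" "\<And>r. r \<le> D \<Longrightarrow> r \<in> N r"
      "\<And>r i j. i \<in> N r \<Longrightarrow> r \<le> j \<Longrightarrow> j \<le> i \<Longrightarrow> j \<in> N r"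
    and project: "\<And>i. i \<le> D \<Longrightarrow> realizable (\<lambda>r a b. if a = i \<and> b = i then 1 else 0)"
    and raise: "\<And>i. i < D \<Longrightarrow> realizable (\<lambda>r a b. if a = Suc i \<and> b = i then \<alpha> i r else 0)"
    and \<alpha>: "\<And>r i. r \<le> D \<Longrightarrow> i \<in> N r \<Longrightarrow> Suc i \<in> N r \<Longrightarrow> \<alpha> i r \<noteq> 0"
    and lower: "\<And>i. i < D \<Longrightarrow> realizable (\<lambda>r a b. if a = i \<and> b = Suc i then \<beta> i r else 0)"
    and \<beta>: "\<And>r i. r \<le> D \<Longrightarrow> i \<in> N r \<Longrightarrow> Suc i \<in> N r \<Longrightarrow> \<beta> i r \<noteq> 0"
    and "s \<le> D" "i \<in> N s" "j \<in> N s"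
  shows "realizable (unit_block s i j)"
proof -
  \<comment> \<open>For \<open>r \<le> s\<close> the whole path from \<open>s\<close> to
    \<open>i\<close> stays inside \<open>N r\<close> once \<open>i\<close> does, so no factor
    vanishes.\<close>
  have up: "\<exists>\<rho>. realizable (\<lambda>r a b. if a = i \<and> b = s then \<rho> r else 0) \<and> (\<forall>r\<le>s. i \<in> N r \<longrightarrow> \<rho> r \<noteq> 0)"
    if "s \<le> i" "i \<le> D" for s i
    using that
  proof (induction i rule: dec_induct)
    case base
    then show ?case using project[of s] by (intro exI[of _ "\<lambda>_. 1"]) auto
  next
    case (step i)
    then obtain \<rho> where \<rho>: "realizable (\<lambda>r a b. if a = i \<and> b = s then \<rho> r else 0)"
      "\<And>r. r \<le> s \<Longrightarrow> i \<in> N r \<Longrightarrow> \<rho> r \<noteq> 0" by auto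
    have "realizable (\<lambda>r a b. if a = Suc i \<and> b = s then (if i \<in> N r then \<alpha> i r * \<rho> r else 0) else 0)"
      using step by (intro realizable_mul_entry raise \<rho>) auto
    moreover have "\<alpha> i r \<noteq> 0 \<and> \<rho> r \<noteq> 0 \<and> i \<in> N r" if "r \<le> s" "Suc i \<in> N r" for r
      using that step N(3)[of "Suc i" r i] \<alpha> \<rho>(2) by auto
    ultimately show ?case by (intro exI[of _ "\<lambda>r. if i \<in> N r then \<alpha> i r * \<rho> r else 0"]) auto
  qed
  have down: "\<exists>\<rho>. realizable (\<lambda>r a b. if a = s \<and> b = i then \<rho> r else 0) \<and> (\<forall>r\<le>s. i \<in> N r \<longrightarrow> \<rho> r \<noteq> 0)"
    if "s \<le> i" "i \<le> D" for s i
    using that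
  proof (induction i rule: dec_induct)
    case base
    then show ?case using project[of s] by (intro exI[of _ "\<lambda>_. 1"]) auto
  next
    case (step i)
    then obtain \<rho> where \<rho>: "realizable (\<lambda>r a b. if a = s \<and> b = i then \<rho> r else 0)"
      "\<And>r. r \<le> s \<Longrightarrow> i \<in> N r \<Longrightarrow> \<rho> r \<noteq> 0" by auto
    have "realizable (\<lambda>r a b. if a = s \<and> b = Suc i then (if i \<in> N r then \<rho> r * \<beta> i r else 0) else 0)"
      using step by (intro realizable_mul_entry lower \<rho>) auto
    moreover have "\<beta> i r \<noteq> 0 \<and> \<rho> r \<noteq> 0 \<and> i \<in> N r" if "r \<le> s" "Suc i \<in> N r" for r
      using that step N(3)[of "Suc i" r i] \<beta> \<rho>(2) by auto
    ultimately show ?case by (intro exI[of _ "\<lambda>r. if i \<in> N r then \<rho> r * \<beta> i r else 0"]) auto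
  qed
  show ?thesis
    using assms(9-)
  proof (induction s rule: less_induct)
    case (less s)
    have ij: "s \<le> i" "i \<le> D" "s \<le> j" "j \<le> D" using less.prems N(1)[of s] by auto
    obtain \<rho> \<sigma> where \<rho>: "realizable (\<lambda>r a b. if a = i \<and> b = s then \<rho> r else 0)" "\<rho> s \<noteq> 0"
      and \<sigma>: "realizable (\<lambda>r a b. if a = s \<and> b = j then \<sigma> r else 0)" "\<sigma> s \<noteq> 0"
      using up[OF ij(1,2)] down[OF ij(3,4)] less.prems by blast
    define \<tau> where "\<tau> r = (if s \<in> N r then \<rho> r * \<sigma> r else 0)" for r
    have \<tau>: "realizable (\<lambda>r a b. if a = i \<and> b = j then \<tau> r else 0)"
      unfolding \<tau>_def by (rule realizable_mul_entry[OF \<rho>(1) \<sigma>(1)])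
    have \<tau>s: "\<tau> s \<noteq> 0" using \<rho> \<sigma> N(2) less.prems by (simp add: \<tau>_def)
    have \<tau>0: "\<tau> r = 0" if "r > s" for r using that N(1)[of r] by (auto simp: \<tau>_def)
    \<comment> \<open>The blocks below \<open>s\<close> that have an \<open>(i, j)\<close> entry; by
      induction their units are available for subtraction.\<close>
    define R where "R = {r. r < s \<and> i \<in> N r \<and> j \<in> N r}"
    have R: "finite R" by (simp add: R_def)
    have "realizable (\<lambda>r a b. \<Sum>q\<in>R. - \<tau> q * unit_block q i j r a b)"
      using less by (intro realizable_sum R realizable_scale less.IH) (auto simp: R_def)
    from realizable_scale[OF realizable_add[OF \<tau> this], of "1 / \<tau> s"]
    show ?case
    proof (rule realizable_cong)
      fix r a b assume *: "r \<le> D" "a \<in> N r" "b \<in> N r"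
      have "(\<Sum>q\<in>R. - \<tau> q * unit_block q i j r a b)
          = (\<Sum>q\<in>R. if q = r then (if a = i \<and> b = j then - \<tau> r else 0) else 0)"
        by (rule sum.cong) (auto simp: unit_block_def)
      also have "\<dots> = (if r \<in> R \<and> a = i \<and> b = j then - \<tau> r else 0)"
        using R by simp
      finally show "1 / \<tau> s * ((if a = i \<and> b = j then \<tau> r else 0)
          + (\<Sum>q\<in>R. - \<tau> q * unit_block q i j r a b)) = unit_block s i j r a b"
        using * \<tau>s \<tau>0[of r] by (cases r s rule: linorder_cases) (auto simp: R_def unit_block_def)
    qed
  qed
qed

end

section \<open>The folded cube\<close>

definition flip :: "'a set \<Rightarrow> 'a \<Rightarrow> 'a set" where
  "flip u s = (if s \<in> u then u - {s} else insert s u)"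

lemma sum_flip:
  assumes "finite S" "u \<subseteq> S"
  shows "(\<Sum>s\<in>S. f (flip u s)) = (\<Sum>s\<in>u. f (u - {s})) + (\<Sum>s\<in>S - u. (f (insert s u) :: complex))"
proof -
  have "(\<Sum>s\<in>S. f (flip u s)) = (\<Sum>s\<in>S - u. f (flip u s)) + (\<Sum>s\<in>u. f (flip u s))"
    by (rule sum.subset_diff[OF assms(2,1)])
  then show ?thesis by (simp add: flip_def add.commute)
qed

lemma mem_flip_iff: "x \<in> flip u s \<longleftrightarrow> (if x = s then x \<notin> u else x \<in> u)"
  by (auto simp: flip_def)

lemma sym_diff_flip: "sym_diff (flip u s) v = flip (sym_diff u v) s"
proof (rule set_eqI)
  fix x
  show "x \<in> sym_diff (flip u s) v \<longleftrightarrow> x \<in> flip (sym_diff u v) s"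
    by (cases "x = s") (auto simp: mem_flip_iff)
qed

lemma sym_diff_eq_flip_iff: "sym_diff u v = {s} \<longleftrightarrow> v = flip u s"
proof -
  have "(x \<in> sym_diff u v \<longleftrightarrow> x \<in> {s}) \<longleftrightarrow> (x \<in> v \<longleftrightarrow> x \<in> flip u s)" for x
    by (auto simp: mem_flip_iff)
  then show ?thesis by (simp only: set_eq_iff)
qed

locale folded_cube =
  fixes D :: nat and lab :: labelling
  assumes D_gt: "D > 1" and labelling: "fc_labelling D lab"
begin

abbreviation "S \<equiv> fc_ground D"
abbreviation "X \<equiv> fc_vertices D"
abbreviation part :: "vertex \<Rightarrow> nat set" where "part x \<equiv> fst (lab x)"
abbreviation lev :: "vertex \<Rightarrow> nat" where "lev x \<equiv> card (fst (lab x))"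

text \<open>A vertex named by either of its parts, so that computations run over subsets of
  \<open>S\<close> without reference to the labelling.\<close>

definition vtx :: "nat set \<Rightarrow> vertex" where
  "vtx u = {u, S - u}"

lemma finite_S [simp]: "finite S" and card_S [simp]: "card S = 2 * D"
  by (auto simp: fc_ground_def)

lemma finite_sub: "u \<subseteq> S \<Longrightarrow> finite u"
  using finite_S finite_subset by blast

lemma card_sub: "u \<subseteq> S \<Longrightarrow> card u \<le> 2 * D"
  using card_mono[OF finite_S] by simp

lemma card_compl: "u \<subseteq> S \<Longrightarrow> card (S - u) = 2 * D - card u"
  by (simp add: card_Diff_subset finite_sub)

lemma vtx_in: "u \<subseteq> S \<Longrightarrow> vtx u \<in> X"
  by (auto simp: vtx_def fc_vertices_def)

lemma vtx_compl: "u \<subseteq> S \<Longrightarrow> vtx (S - u) = vtx u"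
  by (auto simp: vtx_def double_diff)

lemma vtx_eq_iff: "u \<subseteq> S \<Longrightarrow> v \<subseteq> S \<Longrightarrow> vtx u = vtx v \<longleftrightarrow> v = u \<or> v = S - u"
  by (auto simp: vtx_def doubleton_eq_iff)

lemma vertex:
  assumes "x \<in> X"
  shows part_sub: "part x \<subseteq> S" and vtx_part: "vtx (part x) = x"
    and snd_lab: "snd (lab x) = S - part x" and lev_le: "lev x \<le> D"
proof -
  obtain u u' where u: "x = {u, u'}" "u \<inter> u' = {}" "u \<union> u' = S"
    using assms by (auto simp: fc_vertices_def)
  have x: "x = {part x, snd (lab x)}" and le: "lev x \<le> card (snd (lab x))"
    using labelling assms by (auto simp: fc_labelling_def)
  then have "part x = u \<and> snd (lab x) = u' \<or> part x = u' \<and> snd (lab x) = u"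
    using u by (metis doubleton_eq_iff)
  then show sub: "part x \<subseteq> S" and compl: "snd (lab x) = S - part x"
    using u by auto
  then show "vtx (part x) = x" using x by (simp add: vtx_def)
  show "lev x \<le> D"
    using le compl card_compl[OF sub] by simp
qed

lemma part_vtx: "u \<subseteq> S \<Longrightarrow> part (vtx u) = u \<or> part (vtx u) = S - u"
  using vtx_eq_iff[of u "part (vtx u)"] vtx_part[OF vtx_in, of u] part_sub[OF vtx_in, of u] by simp

lemma lev_vtx: "u \<subseteq> S \<Longrightarrow> lev (vtx u) = min (card u) (2 * D - card u)"
  using part_vtx[of u] lev_le[OF vtx_in, of u] card_compl[of u] card_sub[of u] by (auto simp: min_def)

lemma part_vtx_small: "u \<subseteq> S \<Longrightarrow> card u < D \<Longrightarrow> part (vtx u) = u"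
  using part_vtx[of u] lev_vtx[of u] card_compl[of u] by auto

lemma finite_X [simp]: "finite X"
proof -
  have "X \<subseteq> vtx ` Pow S"
    using vtx_part part_sub by (metis PowI image_eqI subsetI)
  then show ?thesis by (rule finite_subset) simp
qed

lemma sum_lev_small:
  assumes "i < D"
  shows "(\<Sum>x | x \<in> X \<and> lev x = i. f x) = (\<Sum>u\<in>level S i. f (vtx u))"
proof (rule sum.reindex_bij_witness[where i = vtx and j = part])
  fix u assume "u \<in> level S i"
  then show "part (vtx u) = u" "vtx u \<in> {x. x \<in> X \<and> lev x = i}"
    using assms part_vtx_small[of u] vtx_in[of u] by (simp_all add: level_def)
next
  fix x assume "x \<in> {x. x \<in> X \<and> lev x = i}"
  then show "vtx (part x) = x" "part x \<in> level S i" "f (vtx (part x)) = f x"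
    using vtx_part[of x] part_sub[of x] by (simp_all add: level_def)
qed

text \<open>A vertex of level \<open>D\<close> comes from two \<open>D\<close>-sets, its
  complementary parts.\<close>

lemma sum_lev_D: "(\<Sum>u\<in>level S D. f (vtx u)) = 2 * (\<Sum>x | x \<in> X \<and> lev x = D. (f x :: complex))"
proof -
  have "(\<Sum>u\<in>level S D. f (vtx u)) = (\<Sum>x | x \<in> X \<and> lev x = D. \<Sum>u | u \<in> level S D \<and> vtx u = x. f (vtx u))"
    using vtx_in lev_vtx by (intro sum.group[symmetric]) (simp, simp, force simp: level_def)
  also have "\<dots> = (\<Sum>x | x \<in> X \<and> lev x = D. 2 * f x)"
  proof (rule sum.cong[OF refl])
    fix x assume x: "x \<in> {x. x \<in> X \<and> lev x = D}"
    then have sub: "part x \<subseteq> S" and v: "vtx (part x) = x" using part_sub vtx_part by auto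
    have "{u. u \<in> level S D \<and> vtx u = x} = {part x, S - part x}"
    proof (rule set_eqI)
      fix u
      have "card (part x) = D" using x by simp
      then show "u \<in> {u. u \<in> level S D \<and> vtx u = x} \<longleftrightarrow> u \<in> {part x, S - part x}"
        using sub v vtx_eq_iff[OF sub, of u] card_compl[OF sub] vtx_compl[OF sub]
        by (simp add: level_def) (metis Diff_subset)
    qed
    moreover have "part x \<noteq> {}" using x D_gt by auto
    then have "part x \<noteq> S - part x" by auto
    moreover have "vtx (S - part x) = x" using v vtx_compl[OF sub] by simp
    ultimately show "(\<Sum>u | u \<in> level S D \<and> vtx u = x. f (vtx u)) = 2 * f x"
      using v by simp
  qed
  finally show ?thesis by (simp add: sum_distrib_left)
qed

section \<open>Distances and adjacency in the folded cube\<close>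

lemma card_sym_diff_compl:
  assumes "u \<subseteq> S" "v \<subseteq> S"
  shows "card (sym_diff u (S - v)) = 2 * D - card (sym_diff u v)"
    and "card (sym_diff (S - u) v) = 2 * D - card (sym_diff u v)"
proof -
  have "sym_diff u (S - v) = S - sym_diff u v" "sym_diff (S - u) v = S - sym_diff u v"
    using assms by auto
  moreover have "sym_diff u v \<subseteq> S" using assms by auto
  ultimately show "card (sym_diff u (S - v)) = 2 * D - card (sym_diff u v)"
    "card (sym_diff (S - u) v) = 2 * D - card (sym_diff u v)"
    using card_compl by metis+
qed

text \<open>Complementing one representative replaces the distance \<open>d\<close> in the cube by
  \<open>2 * D - d\<close>, which the minimum does not notice; any representatives may therefore be
  used.\<close>

lemma fc_dist_vtx:
  assumes "u \<subseteq> S" "v \<subseteq> S"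
  shows "fc_dist lab (vtx u) (vtx v) = min (card (sym_diff u v)) (2 * D - card (sym_diff u v))"
proof -
  have le: "card (sym_diff u v) \<le> 2 * D" using assms by (intro card_sub) auto
  have "fc_dist lab (vtx u) (vtx v)
      = min (card (sym_diff (part (vtx u)) (part (vtx v)))) (card (sym_diff (part (vtx u)) (S - part (vtx v))))"
    using snd_lab[OF vtx_in[OF assms(2)]] by (simp add: fc_dist_def Let_def case_prod_beta)
  also have "\<dots> = min (card (sym_diff (part (vtx u)) (part (vtx v)))) (2 * D - card (sym_diff (part (vtx u)) (part (vtx v))))"
    using part_sub vtx_in assms by (simp add: card_sym_diff_compl)
  also have "card (sym_diff (part (vtx u)) (part (vtx v))) = card (sym_diff u v) \<or>
      card (sym_diff (part (vtx u)) (part (vtx v))) = 2 * D - card (sym_diff u v)"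
    using part_vtx[OF assms(1)] part_vtx[OF assms(2)] card_sym_diff_compl[OF assms]
      card_sym_diff_compl(1)[of "S - u" v] assms le by auto
  then have "min (card (sym_diff (part (vtx u)) (part (vtx v)))) (2 * D - card (sym_diff (part (vtx u)) (part (vtx v))))
      = min (card (sym_diff u v)) (2 * D - card (sym_diff u v))"
    using le by auto
  finally show ?thesis .
qed

lemma fc_dist_zero: "x \<in> X \<Longrightarrow> fc_dist lab (fc_zero D) x = lev x"
  using fc_dist_vtx[of "{}" "part x"] part_sub[of x] vtx_part[of x] lev_le[of x]
  by (simp add: fc_zero_def vtx_def)

lemma flip_sub: "u \<subseteq> S \<Longrightarrow> s \<in> S \<Longrightarrow> flip u s \<subseteq> S"
  by (auto simp: flip_def)

lemma card_flip: "u \<subseteq> S \<Longrightarrow> card (flip u s) = (if s \<in> u then card u - 1 else card u + 1)"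
  by (simp add: flip_def finite_sub)

text \<open>Flips at two different points could give the same vertex only by being complementary,
  which would force \<open>S\<close> to have at most two points.\<close>

lemma neighbours:
  assumes u: "u \<subseteq> S"
  shows "bij_betw (\<lambda>s. vtx (flip u s)) S {y \<in> X. fc_dist lab (vtx u) y = 1}"
  unfolding bij_betw_def
proof
  show "inj_on (\<lambda>s. vtx (flip u s)) S"
  proof (rule inj_onI)
    fix s t assume st: "s \<in> S" "t \<in> S" "vtx (flip u s) = vtx (flip u t)"
    then consider "flip u t = flip u s" | "flip u t = S - flip u s"
      using vtx_eq_iff u flip_sub by metis
    then show "s = t"
    proof cases
      case 1
      then show ?thesis by (metis sym_diff_eq_flip_iff singleton_inject)
    next
      case 2
      then have "S \<subseteq> {s, t}" by (auto simp: flip_def split: if_splits)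
      then have "card S \<le> card {s, t}" by (intro card_mono) auto
      also have "\<dots> \<le> 2" by (simp add: card_insert_if)
      finally show ?thesis using D_gt by simp
    qed
  qed
  show "(\<lambda>s. vtx (flip u s)) ` S = {y \<in> X. fc_dist lab (vtx u) y = 1}"
  proof (intro equalityI subsetI)
    fix y assume "y \<in> (\<lambda>s. vtx (flip u s)) ` S"
    then obtain s where s: "s \<in> S" "y = vtx (flip u s)" by auto
    have "sym_diff u (flip u s) = {s}" by (simp add: sym_diff_eq_flip_iff)
    then have "fc_dist lab (vtx u) y = 1"
      using s fc_dist_vtx[OF u flip_sub[OF u s(1)]] D_gt by simp
    then show "y \<in> {y \<in> X. fc_dist lab (vtx u) y = 1}"
      using s vtx_in flip_sub u by simp
  next
    fix y assume "y \<in> {y \<in> X. fc_dist lab (vtx u) y = 1}"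
    then have y: "y \<in> X" "fc_dist lab (vtx u) (vtx (part y)) = 1" using vtx_part by auto
    define v where "v = part y"
    have v: "v \<subseteq> S" "vtx v = y" using part_sub vtx_part y by (auto simp: v_def)
    have "card (sym_diff u v) = 1 \<or> card (sym_diff u (S - v)) = 1"
      using y fc_dist_vtx[OF u v(1)] card_sym_diff_compl[OF u v(1)] by (auto simp: v_def min_def split: if_splits)
    then obtain v' s where v': "v' \<subseteq> S" "vtx v' = y" "sym_diff u v' = {s}"
      using v vtx_compl by (metis card_1_singletonE Diff_subset)
    then have "s \<in> S" using u by auto
    moreover have "v' = flip u s" using v' sym_diff_eq_flip_iff by metis
    ultimately show "y \<in> (\<lambda>s. vtx (flip u s)) ` S" using v' by blast
  qed
qed

lemma sum_A1:
  assumes u: "u \<subseteq> S"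
  shows "(\<Sum>y\<in>X. fc_A D lab 1 (vtx u) y * f y) = (\<Sum>s\<in>S. f (vtx (flip u s)))"
proof -
  have "(\<Sum>y\<in>X. fc_A D lab 1 (vtx u) y * f y) = (\<Sum>y\<in>X. if fc_dist lab (vtx u) y = 1 then f y else 0)"
    by (rule sum.cong) (use u vtx_in in \<open>auto simp: fc_A_def\<close>)
  also have "\<dots> = (\<Sum>y\<in>{y \<in> X. fc_dist lab (vtx u) y = 1}. f y)"
    by (simp add: sum.inter_filter)
  also have "\<dots> = (\<Sum>s\<in>S. f (vtx (flip u s)))"
    by (rule sum.reindex_bij_betw[OF neighbours[OF u], symmetric])
  finally show ?thesis .
qed

lemma fc_A_sym: "fc_A D lab k x y = fc_A D lab k y x"
proof -
  have "fc_dist lab x y = fc_dist lab y x" if "x \<in> X" "y \<in> X"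
    using fc_dist_vtx[of "part x" "part y"] fc_dist_vtx[of "part y" "part x"] that part_sub vtx_part
    by (simp add: Un_commute)
  then show ?thesis by (auto simp: fc_A_def)
qed

text \<open>Splits \<open>A\<^sub>1\<close> into a lowering and a raising sum around a
  representative \<open>u\<close>, ready for the two ladder identities.\<close>

lemma mat_vec_A1:
  assumes u: "u \<subseteq> S"
  shows "mat_vec X (fc_A D lab 1) v (vtx u) = (\<Sum>s\<in>u. v (vtx (u - {s}))) + (\<Sum>s\<in>S - u. v (vtx (insert s u)))"
  unfolding mat_vec_def sum_A1[OF u] by (rule sum_flip[OF finite_S u])

lemma fc_A_mat_space: "fc_A D lab k \<in> mat_space X"
  and fc_Estar_mat_space: "fc_Estar D lab k \<in> mat_space X"
  by (auto simp: fc_A_def fc_Estar_def mat_space_def)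

lemma fc_A_0: "fc_A D lab 0 = mat_one X"
proof (intro ext)
  fix x y
  have "fc_dist lab x y = 0 \<longleftrightarrow> x = y" if xy: "x \<in> X" "y \<in> X"
  proof
    have p: "part x \<subseteq> S" "part y \<subseteq> S" "vtx (part x) = x" "vtx (part y) = y"
      using part_sub vtx_part xy by auto
    have d: "fc_dist lab x y = min (card (sym_diff (part x) (part y))) (card (sym_diff (part x) (S - part y)))"
      using fc_dist_vtx[OF p(1,2)] card_sym_diff_compl[OF p(1,2)] p by simp
    have "finite (sym_diff (part x) (part y))" "finite (sym_diff (part x) (S - part y))"
      using p finite_sub by auto
    moreover assume "fc_dist lab x y = 0"
    ultimately have "sym_diff (part x) (part y) = {} \<or> sym_diff (part x) (S - part y) = {}"
      using d by (metis card_0_eq min_def)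
    then have "part x = part y \<or> part x = S - part y" by auto
    then show "x = y" using p vtx_compl by metis
  next
    assume "x = y"
    then show "fc_dist lab x y = 0"
      using fc_dist_vtx[of "part x" "part x"] part_sub vtx_part xy by simp
  qed
  then show "fc_A D lab 0 x y = mat_one X x y"
    by (auto simp: fc_A_def mat_one_def)
qed

text \<open>The three-term recurrence of a distance-regular graph, without a term in
  \<open>A\<^sub>k\<close> because a flip always changes the distance. The count takes the flips of
  a representative at distance \<open>a\<close> in the cube.\<close>

lemma fc_A_recurrence:
  assumes k: "1 \<le> k" "k < D"
  shows "mat_mul X (fc_A D lab 1) (fc_A D lab k)
      = mat_scale (of_nat (if k + 1 = D then 2 * D else k + 1)) (fc_A D lab (k + 1))
        + mat_scale (of_nat (2 * D - k + 1)) (fc_A D lab (k - 1))" (is "?L = ?R")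
proof (intro ext)
  fix x y
  show "?L x y = ?R x y"
  proof (cases "x \<in> X \<and> y \<in> X")
    case False
    then show ?thesis by (auto simp: mat_mul_def fc_A_def mat_scale_def)
  next
    case True
    define u v where uv: "u = part x" "v = part y"
    have u: "u \<subseteq> S" "vtx u = x" and v: "v \<subseteq> S" "vtx v = y"
      using True part_sub vtx_part by (auto simp: uv)
    define w where "w = sym_diff u v"
    have w: "w \<subseteq> S" using u v by (auto simp: w_def)
    define a where "a = card w"
    have a: "a \<le> 2 * D" using card_sub[OF w] by (simp add: a_def)
    define m where "m b = min b (2 * D - b)" for b
    have dist: "fc_dist lab x y = m a"
      using fc_dist_vtx[OF u(1) v(1)] u v by (simp add: m_def a_def w_def)
    have flip_dist: "fc_dist lab (vtx (flip u s)) y = m (if s \<in> w then a - 1 else a + 1)" if "s \<in> S" for s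
    proof -
      have "sym_diff (flip u s) v = flip w s" unfolding w_def by (rule sym_diff_flip)
      then show ?thesis
        using fc_dist_vtx[OF flip_sub[OF u(1) that] v(1)] v(2)
        by (simp only: card_flip[OF w] a_def m_def)
    qed
    have "?L x y = (\<Sum>s\<in>S. fc_A D lab k (vtx (flip u s)) y)"
      using sum_A1[OF u(1), of "\<lambda>z. fc_A D lab k z y"] u by (simp add: mat_mul_def)
    also have "\<dots> = (\<Sum>s\<in>S. if m (if s \<in> w then a - 1 else a + 1) = k then 1 else 0)"
      using True flip_dist vtx_in flip_sub[OF u(1)] by (intro sum.cong) (auto simp: fc_A_def)
    also have "\<dots> = (\<Sum>s\<in>S - w. if m (a + 1) = k then 1 else 0) + (\<Sum>s\<in>w. if m (a - 1) = k then 1 else 0)"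
      by (subst sum.subset_diff[OF w]) auto
    also have "\<dots> = of_nat ((if m (a - 1) = k then a else 0) + (if m (a + 1) = k then 2 * D - a else 0))"
      using card_compl[OF w] by (auto simp: a_def)
    also have "(if m (a - 1) = k then a else 0) + (if m (a + 1) = k then 2 * D - a else 0)
        = (if m a = k + 1 then (if k + 1 = D then 2 * D else k + 1) else 0)
          + (if m a = k - 1 then 2 * D - k + 1 else 0)"
    proof -
      have m: "m b = b" if "b \<le> D" for b using that by (simp add: m_def)
      have m': "m b = 2 * D - b" if "D \<le> b" for b using that by (simp add: m_def)
      consider "a < D" | "a = D" | "D < a" by linarith
      then show ?thesis
      proof cases
        case 1
        then have "m (a - 1) = a - 1" "m (a + 1) = a + 1" "m a = a" using m by auto
        then show ?thesis using 1 k by auto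
      next
        \<comment> \<open>Here every one of the \<open>2 * D\<close> flips decreases the folded
          distance, which explains the exceptional coefficient.\<close>
        case 2
        then have "m (a - 1) = D - 1" "m (a + 1) = D - 1" "m a = D" using m m'[of "a + 1"] by auto
        then show ?thesis using 2 k by auto
      next
        \<comment> \<open>Beyond the middle the roles of adding and deleting are exchanged;
          \<open>c\<close> is the folded distance.\<close>
        case 3
        define c where "c = 2 * D - a"
        have c: "2 * D - a = c" "c < D" using 3 a by (simp_all add: c_def)
        have "m (a - 1) = c + 1" "m (a + 1) = c - 1" "m a = c"
          using 3 a m'[of "a - 1"] m'[of "a + 1"] m'[of a] by (simp_all add: c_def)
        moreover have "a = 2 * D - k + 1" if "c + 1 = k" using that a k by (simp add: c_def)
        ultimately show ?thesis using c k by auto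
      qed
    qed
    finally show ?thesis
      using True dist by (auto simp: mat_scale_def fc_A_def)
  qed
qed

section \<open>Dual idempotents and the lowering matrices by levels\<close>

lemma fc_Estar_eq: "fc_Estar D lab k = (\<lambda>x y. if x \<in> X \<and> x = y \<and> lev y = k then 1 else 0)"
  by (auto simp: fc_Estar_def fun_eq_iff fc_dist_zero)

lemma mat_vec_Estar: "mat_vec X (fc_Estar D lab k) v x = (if x \<in> X \<and> lev x = k then v x else 0)"
proof -
  have "mat_vec X (fc_Estar D lab k) v x = (\<Sum>y\<in>X. if y = x then (if lev x = k then v x else 0) else 0)"
    unfolding mat_vec_def fc_Estar_eq by (rule sum.cong) auto
  then show ?thesis by simp
qed

text \<open>The matrix that defines \<open>\<L>\<^sub>r\<close> is the part of
  \<open>A\<^sub>1\<close> leading from level \<open>r\<close> to level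
  \<open>r - 1\<close>.\<close>

lemma fc_M_adjacent:
  assumes "1 \<le> r" "r \<le> D"
  shows "fc_M D lab (r - 1) r (r - 1) x y = (if lev x = r - 1 \<and> lev y = r then fc_A D lab 1 x y else 0)"
proof (cases "x \<in> X \<and> y \<in> X \<and> lev x = r - 1 \<and> lev y = r")
  case False
  then show ?thesis by (auto simp: fc_M_def fc_triple_def fc_A_def Let_def case_prod_beta)
next
  case True
  define u v where uv: "u = part x" "v = part y"
  have u: "u \<subseteq> S" "vtx u = x" "card u = r - 1" and v: "v \<subseteq> S" "vtx v = y" "card v = r"
    using True part_sub vtx_part by (auto simp: uv)
  define t where "t = card (u \<inter> v)"
  have t: "t \<le> r - 1" using card_mono[of u "u \<inter> v"] finite_sub u by (auto simp: t_def)
  have "u \<inter> (S - v) = u - u \<inter> v" using u by auto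
  then have t': "card (u \<inter> (S - v)) = r - 1 - t"
    using u finite_sub by (simp add: t_def card_Diff_subset)
  have "card (u - v) = r - 1 - t" "card (v - u) = r - t"
    using card_Diff_subset_Int[of u v] card_Diff_subset_Int[of v u] finite_sub u v
    by (simp_all add: t_def Int_commute)
  then have "card (sym_diff u v) = (r - 1 - t) + (r - t)"
    using u v finite_sub by (subst card_Un_disjoint) auto
  also have "\<dots> = 2 * r - 1 - 2 * t" using t by simp
  finally have dist: "fc_dist lab x y = min (2 * r - 1 - 2 * t) (2 * D - (2 * r - 1 - 2 * t))"
    using fc_dist_vtx[OF u(1) v(1)] u(2) v(2) by simp
  have triple: "fc_triple D lab x y = (r - 1, r, if r \<le> D - 1 then t else max t (r - 1 - t))"
    using True u v assms t' snd_lab[of x] snd_lab[of y]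
    by (auto simp: fc_triple_def Let_def case_prod_beta uv[symmetric] t_def)
  \<comment> \<open>For \<open>r = D\<close> a neighbour contains the smaller part in either of its
    two halves: \<open>t = r - 1\<close> or \<open>t = 0\<close>, matching the two terms of the
    folded distance.\<close>
  have "(if r \<le> D - 1 then t else max t (r - 1 - t)) = r - 1 \<longleftrightarrow> fc_dist lab x y = 1"
    unfolding dist using assms t D_gt by (auto simp: min_def max_def)
  then show ?thesis using True triple by (simp add: fc_M_def fc_A_def)
qed

text \<open>Rewrites the kernel condition with \<open>A\<^sub>1\<close> alone; writing it as
  \<open>lev x + 1 = r\<close> makes it vacuous at \<open>r = 0\<close>.\<close>

lemma fc_L_iff:
  assumes "r \<le> D"
  shows "\<xi> \<in> fc_L D lab r \<longleftrightarrow> \<xi> \<in> cvectors X \<and> (\<forall>x\<in>X. lev x \<noteq> r \<longrightarrow> \<xi> x = 0) \<and>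
     (\<forall>x\<in>X. lev x + 1 = r \<longrightarrow> mat_vec X (fc_A D lab 1) \<xi> x = 0)"
proof -
  have "mat_vec X (fc_M D lab (r - 1) r (r - 1)) \<xi> x
      = (if x \<in> X \<and> lev x + 1 = r then mat_vec X (fc_A D lab 1) \<xi> x else 0)"
    if "\<forall>x\<in>X. lev x \<noteq> r \<longrightarrow> \<xi> x = 0" "r > 0" for x
  proof (cases "x \<in> X \<and> lev x + 1 = r")
    case True
    then have "fc_M D lab (r - 1) r (r - 1) x y * \<xi> y = fc_A D lab 1 x y * \<xi> y" if "y \<in> X" for y
      using \<open>\<forall>x\<in>X. lev x \<noteq> r \<longrightarrow> \<xi> x = 0\<close> that assms fc_M_adjacent[of r x y] by auto
    then have "mat_vec X (fc_M D lab (r - 1) r (r - 1)) \<xi> x = mat_vec X (fc_A D lab 1) \<xi> x"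
      unfolding mat_vec_def by (rule sum.cong[OF refl])
    then show ?thesis using True by simp
  next
    case False
    then have "fc_M D lab (r - 1) r (r - 1) x y = 0" for y
      using that assms fc_M_adjacent[of r x y] by (auto simp: fc_M_def)
    then show ?thesis using False by (auto simp: mat_vec_def)
  qed
  then show ?thesis
    unfolding fc_L_def
    by (cases "r = 0") (auto simp: fun_eq_iff simp del: One_nat_def split: if_split_asm)
qed

end

section \<open>Lifting vectors to the subset lattice\<close>

text \<open>
  The coefficients of \<open>\<Prod>k=1..r. (e\<^bsub>2k-1\<^esub> - e\<^bsub>2k\<^esub>)\<close>: the witness that no \<open>\<L>\<^sub>r\<close> is zero.
\<close>

definition pair_product :: "nat \<Rightarrow> nat set \<Rightarrow> complex" where
  "pair_product r w = (if w \<subseteq> {1..2 * r} then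
     \<Prod>k\<in>{1..r}. (if 2 * k - 1 \<in> w then 1 else 0) - (if 2 * k \<in> w then 1 else 0) else 0)"

lemma sum_pairs:
  fixes f :: "nat \<Rightarrow> complex"
  shows "(\<Sum>s\<in>{1..2 * r}. f s) = (\<Sum>k\<in>{1..r}. f (2 * k - 1) + f (2 * k))"
  by (induction r) auto

text \<open>Only factor \<open>k\<close> changes. If \<open>a\<close> contains neither point of the
  pair, the factor becomes 1 and -1; if it contains exactly one, inserting the other makes it
  0.\<close>

lemma pair_product_insert_cancel:
  assumes "1 \<le> k" "k \<le> r"
  shows "(if 2 * k - 1 \<notin> a then pair_product r (insert (2 * k - 1) a) else 0)
    + (if 2 * k \<notin> a then pair_product r (insert (2 * k) a) else 0) = 0"
proof -
  define \<epsilon> :: "nat set \<Rightarrow> nat \<Rightarrow> complex"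
    where "\<epsilon> w j = (if 2 * j - 1 \<in> w then 1 else 0) - (if 2 * j \<in> w then 1 else 0)" for w j
  have split: "pair_product r w = (if w \<subseteq> {1..2 * r} then \<epsilon> w k * (\<Prod>j\<in>{1..r} - {k}. \<epsilon> w j) else 0)" for w
    unfolding pair_product_def \<epsilon>_def[symmetric]
    using assms by (subst prod.remove[of "{1..r}" k]) auto
  have other: "(\<Prod>j\<in>{1..r} - {k}. \<epsilon> (insert s a) j) = (\<Prod>j\<in>{1..r} - {k}. \<epsilon> a j)"
    if "s = 2 * k - 1 \<or> s = 2 * k" for s
  proof (rule prod.cong[OF refl])
    fix j assume "j \<in> {1..r} - {k}"
    then have "2 * j - 1 \<noteq> s" "2 * j \<noteq> s" using that assms by auto
    then show "\<epsilon> (insert s a) j = \<epsilon> a j" by (simp add: \<epsilon>_def)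
  qed
  have ne: "2 * k - 1 \<noteq> 2 * k" using assms by simp
  have *: "pair_product r (insert (2 * k - 1) a)
      = (if a \<subseteq> {1..2 * r} then (1 - (if 2 * k \<in> a then 1 else 0)) * (\<Prod>j\<in>{1..r} - {k}. \<epsilon> a j) else 0)"
    using assms ne other[of "2 * k - 1"] by (auto simp: split \<epsilon>_def)
  have **: "pair_product r (insert (2 * k) a)
      = (if a \<subseteq> {1..2 * r} then ((if 2 * k - 1 \<in> a then 1 else 0) - 1) * (\<Prod>j\<in>{1..r} - {k}. \<epsilon> a j) else 0)"
    using assms ne other[of "2 * k"] by (auto simp: split \<epsilon>_def)
  show ?thesis unfolding * ** by auto
qed

text \<open>Points above \<open>2 * r\<close> contribute 0, and the remaining ones cancel pair by
  pair.\<close>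

lemma sum_pair_product_insert:
  assumes "r \<le> D"
  shows "(\<Sum>s\<in>{1..2 * D} - a. pair_product r (insert s a)) = 0"
proof -
  have "(\<Sum>s\<in>{1..2 * D} - a. pair_product r (insert s a)) = (\<Sum>s\<in>{1..2 * r} - a. pair_product r (insert s a))"
    by (rule sum.mono_neutral_right) (use assms in \<open>auto simp: pair_product_def\<close>)
  also have "\<dots> = (\<Sum>s\<in>{1..2 * r}. if s \<notin> a then pair_product r (insert s a) else 0)"
    unfolding set_diff_eq by (rule sum.inter_filter) simp
  also have "\<dots> = 0"
    unfolding sum_pairs by (rule sum.neutral, rule ballI, rule pair_product_insert_cancel) auto
  finally show ?thesis .
qed

text \<open>Each factor changes sign. For even \<open>r = D\<close> the function is thus well
  defined on vertices of level \<open>D\<close>.\<close>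

lemma pair_product_complement:
  assumes "w \<subseteq> {1..2 * r}"
  shows "pair_product r ({1..2 * r} - w) = (-1) ^ r * pair_product r w"
proof -
  have "(\<Prod>k\<in>{1..r}. (if 2 * k - 1 \<in> {1..2 * r} - w then 1 else 0) - (if 2 * k \<in> {1..2 * r} - w then 1 else 0))
      = (\<Prod>k\<in>{1..r}. (-1) * ((if 2 * k - 1 \<in> w then 1 else 0) - (if 2 * k \<in> w then 1 else (0::complex))))"
    by (rule prod.cong) auto
  also have "\<dots> = (-1) ^ r * (\<Prod>k\<in>{1..r}. (if 2 * k - 1 \<in> w then 1 else 0) - (if 2 * k \<in> w then 1 else 0))"
    unfolding prod.distrib by simp
  finally show ?thesis using assms by (auto simp: pair_product_def)
qed

lemma pair_product_odds: "pair_product r ((\<lambda>k. 2 * k - 1) ` {1..r}) = 1"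
proof -
  have "2 * k - 1 \<in> (\<lambda>k. 2 * k - 1) ` {1..r}" "2 * k \<notin> (\<lambda>k. 2 * k - 1) ` {1..r}" if "k \<in> {1..r}" for k
    using that by (auto, presburger)
  then show ?thesis
    unfolding pair_product_def by (subst prod.neutral) auto
qed

lemma primitive_subset_sum_self:
  assumes "finite S" "primitive S r g" "w \<subseteq> S" "card w = r"
  shows "subset_sum g w = g w"
proof -
  have "finite w" using assms finite_subset by blast
  have "subset_sum g w = (\<Sum>v\<in>{w}. g v)"
    unfolding subset_sum_def
  proof (rule sum.mono_neutral_right)
    show "\<forall>v\<in>Pow w - {w}. g v = 0"
    proof
      fix v assume v: "v \<in> Pow w - {w}"
      then have "card v < card w" using \<open>finite w\<close> by (intro psubset_card_mono) auto
      then show "g v = 0" using assms v by (auto simp: primitive_def)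
    qed
  qed (use \<open>finite w\<close> in auto)
  then show ?thesis by simp
qed

section \<open>Extensions of vectors of \<open>\<L>\<^sub>r\<close> and the columns of
  \<open>U\<^sub>1\<close>\<close>

context folded_cube
begin

text \<open>At \<open>r = D\<close> both parts of a vertex receive its value, so the lift does not
  depend on the labelling.\<close>

definition lift :: "nat \<Rightarrow> (vertex \<Rightarrow> complex) \<Rightarrow> nat set \<Rightarrow> complex" where
  "lift r \<xi> w = (if w \<subseteq> S \<and> card w = r then \<xi> (vtx w) else 0)"

definition ext :: "nat \<Rightarrow> (vertex \<Rightarrow> complex) \<Rightarrow> nat set \<Rightarrow> complex" where
  "ext r \<xi> = subset_sum (lift r \<xi>)"

text \<open>
  A vertex of level \<open>D\<close> has two lifts, whence the factor \<open>\<surd>2\<close>; for \<open>r = D\<close> it cancels because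
  the lift of \<open>\<xi>\<close> itself then has squared norm 2.
\<close>

definition coef :: "nat \<Rightarrow> nat \<Rightarrow> real" where
  "coef r i = (if r = D then 1 else
     (if i < D then 1 else sqrt 2) * (1 / sqrt (real ((2 * D - 2 * r) choose (i - r)))))"

lemma coef_pos: "r \<le> i \<Longrightarrow> i \<le> D \<Longrightarrow> coef r i > 0"
  by (auto simp: coef_def zero_less_binomial_iff)

lemma fc_L_D:
  assumes "r \<le> D" "\<xi> \<in> fc_L D lab r"
  shows "x \<notin> X \<Longrightarrow> \<xi> x = 0" "x \<in> X \<Longrightarrow> lev x \<noteq> r \<Longrightarrow> \<xi> x = 0"
    "x \<in> X \<Longrightarrow> lev x + 1 = r \<Longrightarrow> mat_vec X (fc_A D lab 1) \<xi> x = 0"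
  using assms fc_L_iff[OF assms(1)] by (auto simp: cvectors_def simp del: One_nat_def)

lemma mat_vec_A1_low:
  assumes "r \<le> D" "a \<subseteq> S" "card a + 1 = r" and supp: "\<And>x. x \<in> X \<Longrightarrow> lev x \<noteq> r \<Longrightarrow> \<xi> x = 0"
  shows "mat_vec X (fc_A D lab 1) \<xi> (vtx a) = (\<Sum>s\<in>S - a. \<xi> (vtx (insert s a)))"
proof -
  have "\<xi> (vtx (a - {s})) = 0" if s: "s \<in> a" for s
  proof (rule supp)
    have sub: "a - {s} \<subseteq> S" using assms by auto
    then show "vtx (a - {s}) \<in> X" by (rule vtx_in)
    have "card (a - {s}) < card a" using s finite_sub[OF assms(2)] by (intro card_Diff1_less)
    then show "lev (vtx (a - {s})) \<noteq> r" using lev_vtx[OF sub] assms by auto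
  qed
  then show ?thesis unfolding mat_vec_A1[OF assms(2)] by simp
qed

text \<open>Below its own level a vector of \<open>\<L>\<^sub>r\<close> sees only the raising half
  of \<open>A\<^sub>1\<close>, so the kernel condition is primitivity at
  \<open>card a + 1 = r\<close>; for other sizes all terms are 0.\<close>

lemma primitive_lift:
  assumes r: "r \<le> D" and \<xi>: "\<xi> \<in> fc_L D lab r"
  shows "primitive S r (lift r \<xi>)"
  unfolding primitive_def
proof (intro conjI allI impI)
  fix a assume a: "a \<subseteq> S"
  have fin: "finite a" using a finite_sub by blast
  show "(\<Sum>s\<in>S - a. lift r \<xi> (insert s a)) = 0"
  proof (cases "card a + 1 = r")
    case False
    then show ?thesis using fin by (intro sum.neutral) (auto simp: lift_def)
  next
    case True
    have "lev (vtx a) + 1 = r" using lev_vtx[OF a] True r by simp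
    then have "(\<Sum>s\<in>S - a. \<xi> (vtx (insert s a))) = 0"
      using mat_vec_A1_low[OF r a True fc_L_D(2)[OF r \<xi>]] fc_L_D(3)[OF r \<xi> vtx_in[OF a]] by simp
    then show ?thesis using True fin a by (simp add: lift_def)
  qed
qed (simp add: lift_def)

lemma ladder_ext: "r \<le> D \<Longrightarrow> \<xi> \<in> fc_L D lab r \<Longrightarrow> ladder S r (ext r \<xi>)"
  unfolding ext_def by (intro ladder_subset_sum primitive_lift) auto

lemma ext_complement:
  "r \<le> D \<Longrightarrow> \<xi> \<in> fc_L D lab r \<Longrightarrow> u \<subseteq> S \<Longrightarrow> ext r \<xi> (S - u) = (-1) ^ r * ext r \<xi> u"
  unfolding ext_def by (intro subset_sum_complement primitive_lift) auto

lemma ext_self: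
  "r \<le> D \<Longrightarrow> \<xi> \<in> fc_L D lab r \<Longrightarrow> w \<subseteq> S \<Longrightarrow> card w = r \<Longrightarrow> ext r \<xi> w = \<xi> (vtx w)"
  unfolding ext_def by (subst primitive_subset_sum_self[OF finite_S primitive_lift]) (auto simp: lift_def)

lemma ext_Reals: "(\<And>x. \<xi> x \<in> \<real>) \<Longrightarrow> ext r \<xi> w \<in> \<real>"
  unfolding ext_def subset_sum_def lift_def by (intro sum_in_Reals) auto

text \<open>Below level \<open>D\<close> each \<open>r\<close>-set is the smaller part of exactly
  one vertex.\<close>

lemma sum_part_subset:
  assumes "r < D" "u \<subseteq> S"
  shows "(\<Sum>y | y \<in> X \<and> lev y = r. if part y \<subseteq> u then \<xi> y else 0) = ext r \<xi> u"
proof -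
  have "(\<Sum>y | y \<in> X \<and> lev y = r. if part y \<subseteq> u then \<xi> y else 0)
      = (\<Sum>w\<in>level S r. if part (vtx w) \<subseteq> u then \<xi> (vtx w) else 0)"
    by (rule sum_lev_small[OF assms(1)])
  also have "\<dots> = (\<Sum>w\<in>level S r. if w \<in> Pow u then lift r \<xi> w else 0)"
    using assms by (intro sum.cong refl) (simp add: level_def part_vtx_small lift_def)
  also have "\<dots> = (\<Sum>w\<in>level S r \<inter> Pow u. lift r \<xi> w)"
    by (rule sum.inter_restrict[symmetric]) simp
  also have "\<dots> = ext r \<xi> u"
    unfolding ext_def subset_sum_def
    using finite_sub[OF assms(2)] by (intro sum.mono_neutral_left) (auto simp: lift_def level_def)
  finally show ?thesis .
qed

text \<open>The overlap reaches its maximum \<open>r\<close> exactly when \<open>part y\<close> lies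
  in \<open>part x\<close> or, at level \<open>D\<close>, in one of the two parts of
  \<open>x\<close>.\<close>

lemma mat_vec_fc_M:
  assumes "r < D" "i \<le> D" "r \<le> i" "x \<in> X"
  shows "mat_vec X (fc_M D lab i r r) \<xi> x = (if lev x = i then
     \<Sum>y | y \<in> X \<and> lev y = r. if part y \<subseteq> part x \<or> (i = D \<and> part y \<subseteq> S - part x) then \<xi> y else 0 else 0)"
proof (cases "lev x = i")
  case False
  then have "fc_M D lab i r r x y = 0" for y
    by (auto simp: fc_M_def fc_triple_def Let_def case_prod_beta)
  then show ?thesis using False by (simp add: mat_vec_def)
next
  case True
  have fin: "finite (part y)" if "y \<in> X" for y using that part_sub finite_sub by blast
  have inter: "card (part x \<inter> part y) = lev y \<longleftrightarrow> part y \<subseteq> part x"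
    "card ((S - part x) \<inter> part y) = lev y \<longleftrightarrow> part y \<subseteq> S - part x"
    "card (part x \<inter> part y) \<le> lev y" "card ((S - part x) \<inter> part y) \<le> lev y" if "y \<in> X" for y
    using fin[OF that] card_subset_eq[OF fin[OF that], of "part x \<inter> part y"]
      card_subset_eq[OF fin[OF that], of "(S - part x) \<inter> part y"]
    by (auto simp: Int_absorb1 intro: card_mono)
  have "fc_M D lab i r r x y * \<xi> y = (if lev y = r then
      if part y \<subseteq> part x \<or> (i = D \<and> part y \<subseteq> S - part x) then \<xi> y else 0 else 0)" if y: "y \<in> X" for y
  proof (cases "lev y = r")
    case False
    then show ?thesis by (auto simp: fc_M_def fc_triple_def Let_def case_prod_beta)
  next
    case r: True
    have "fc_triple D lab x y
        = (i, r, if i \<le> D - 1 then card (part x \<inter> part y)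
             else max (card (part x \<inter> part y)) (card ((S - part x) \<inter> part y)))"
      using assms True r snd_lab[OF assms(4)] by (auto simp: fc_triple_def Let_def case_prod_beta)
    then have "fc_triple D lab x y = (i, r, r) \<longleftrightarrow> part y \<subseteq> part x \<or> (i = D \<and> part y \<subseteq> S - part x)"
      using inter[OF y] r assms by (auto simp: max_def)
    then show ?thesis using r y assms by (simp add: fc_M_def)
  qed
  then have "mat_vec X (fc_M D lab i r r) \<xi> x = (\<Sum>y\<in>X. if lev y = r then
      if part y \<subseteq> part x \<or> (i = D \<and> part y \<subseteq> S - part x) then \<xi> y else 0 else 0)"
    unfolding mat_vec_def by (rule sum.cong[OF refl])
  also have "\<dots> = (\<Sum>y\<in>{y \<in> X. lev y = r}. if part y \<subseteq> part x \<or> (i = D \<and> part y \<subseteq> S - part x) then \<xi> y else 0)"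
    by (rule sum.inter_filter[symmetric]) simp
  finally show ?thesis using True by simp
qed

text \<open>Identifies the columns as normalised levels of the extension. At level \<open>D\<close>
  with \<open>0 < r < D\<close>, the two parts contribute equally because \<open>r\<close> is even,
  so the factor \<open>sqrt 2 / 2\<close> becomes \<open>sqrt 2\<close>.\<close>

lemma fc_u_eq:
  assumes "even D" and r: "r \<le> D" and \<xi>: "\<xi> \<in> fc_L D lab r" and i: "i \<in> fc_N D r"
  shows "fc_u D lab r \<xi> i x = (if x \<in> X \<and> lev x = i then of_real (coef r i) * ext r \<xi> (part x) else 0)"
proof (cases "x \<in> X")
  case False
  then have "mat_vec X (fc_M D lab i' r r) \<xi> x = 0" for i'
    by (simp add: mat_vec_def fc_M_def)
  then show ?thesis using False fc_L_D(1)[OF r \<xi>] by (simp add: fc_u_def cscale_def)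
next
  case x: True
  have ri: "r \<le> i" "i \<le> D" "i = D \<Longrightarrow> even r"
    using i D_gt by (auto simp: fc_N_def split: if_splits)
  have sub: "part x \<subseteq> S" using part_sub x by blast
  consider "r = D" | "r < D" "i < D" | "r < D" "i = D" "r = 0" | "r < D" "i = D" "r > 0" using ri by linarith
  then show ?thesis
  proof cases
    case 1
    then have "i = D" using ri by simp
    then show ?thesis
      using 1 x sub ext_self[OF r \<xi> sub] vtx_part[OF x] fc_L_D(2)[OF r \<xi> x] D_gt by (simp add: fc_u_def coef_def)
  next
    case 2
    then show ?thesis
      using x ri sum_part_subset[OF 2(1) sub, of \<xi>] mat_vec_fc_M[OF 2(1) ri(2,1) x, of \<xi>]
      by (simp add: fc_u_def cscale_def coef_def)
  next
    \<comment> \<open>Both parts of \<open>x\<close> contain the empty set but the matrix entry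
      counts it once, so nothing doubles and the factor is already \<open>sqrt 2\<close>.\<close>
    case 3
    have "(if part y \<subseteq> part x \<or> (i = D \<and> part y \<subseteq> S - part x) then \<xi> y else 0)
        = (if part y \<subseteq> part x then \<xi> y else 0)" if "y \<in> X" "lev y = r" for y
      using that 3 part_sub[of y] finite_sub by auto
    then have "(\<Sum>y | y \<in> X \<and> lev y = r. if part y \<subseteq> part x \<or> (i = D \<and> part y \<subseteq> S - part x) then \<xi> y else 0)
        = (\<Sum>y | y \<in> X \<and> lev y = r. if part y \<subseteq> part x then \<xi> y else 0)"
      by (intro sum.cong) auto
    then have "mat_vec X (fc_M D lab i r r) \<xi> x = (if lev x = i then ext r \<xi> (part x) else 0)"
      using mat_vec_fc_M[OF 3(1) ri(2,1) x, of \<xi>] sum_part_subset[OF 3(1) sub, of \<xi>] by simp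
    then show ?thesis using 3 x D_gt by (simp add: fc_u_def cscale_def coef_def)
  next
    \<comment> \<open>A nonempty set cannot lie in both parts, so the disjunction splits into a
      sum.\<close>
    case 4
    have "(if part y \<subseteq> part x \<or> (i = D \<and> part y \<subseteq> S - part x) then \<xi> y else 0)
        = (if part y \<subseteq> part x then \<xi> y else 0) + (if part y \<subseteq> S - part x then \<xi> y else 0)"
      if "y \<in> X" "lev y = r" for y
    proof -
      have "part y \<noteq> {}" using that 4 by auto
      then show ?thesis using 4 by auto
    qed
    then have "(\<Sum>y | y \<in> X \<and> lev y = r. if part y \<subseteq> part x \<or> (i = D \<and> part y \<subseteq> S - part x) then \<xi> y else 0)
        = (\<Sum>y | y \<in> X \<and> lev y = r.
             (if part y \<subseteq> part x then \<xi> y else 0) + (if part y \<subseteq> S - part x then \<xi> y else 0))"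
      by (intro sum.cong) auto
    also have "\<dots> = ext r \<xi> (part x) + ext r \<xi> (S - part x)"
      unfolding sum.distrib using sum_part_subset[OF 4(1)] sub by simp
    finally have "mat_vec X (fc_M D lab i r r) \<xi> x
        = (if lev x = i then ext r \<xi> (part x) + ext r \<xi> (S - part x) else 0)"
      using mat_vec_fc_M[OF 4(1) ri(2,1) x, of \<xi>] by simp
    then have "mat_vec X (fc_M D lab i r r) \<xi> x = (if lev x = i then 2 * ext r \<xi> (part x) else 0)"
      using ext_complement[OF r \<xi> sub] ri 4 by simp
    then show ?thesis using 4 x D_gt by (simp add: fc_u_def cscale_def coef_def)
  qed
qed

lemma fc_N_D:
  assumes "i \<in> fc_N D r"
  shows "r \<le> i" "i \<le> D" "i = D \<Longrightarrow> even r"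
  using assms D_gt by (auto simp: fc_N_def split: if_splits)

text \<open>Evaluation at an arbitrary representative: passing to the labelled part may cost a
  complement and hence the sign. At level \<open>D\<close> the index \<open>r\<close> is even, so
  both choices agree.\<close>

lemma fc_u_vtx:
  assumes "even D" and r: "r \<le> D" and \<xi>: "\<xi> \<in> fc_L D lab r" and i: "i \<in> fc_N D r" and w: "w \<subseteq> S"
  shows "fc_u D lab r \<xi> i (vtx w) = of_real (coef r i) *
    (if card w = i then ext r \<xi> w else if card w = 2 * D - i then (-1) ^ r * ext r \<xi> w else 0)"
proof -
  note iN = fc_N_D[OF i]
  note eq = fc_u_eq[OF assms(1) r \<xi> i, of "vtx w"]
  have le: "card w \<le> 2 * D" by (rule card_sub[OF w])
  have cw: "card (S - w) = 2 * D - card w" by (rule card_compl[OF w])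
  consider "card w = i" "i < D" | "card w = i" "i = D" | "card w \<noteq> i" "card w = 2 * D - i"
    | "card w \<noteq> i" "card w \<noteq> 2 * D - i" using iN by linarith
  then show ?thesis
  proof cases
    case 1
    then show ?thesis using eq vtx_in[OF w] part_vtx_small[OF w] by simp
  next
    case 2
    then have "ext r \<xi> (part (vtx w)) = ext r \<xi> w"
      using part_vtx[OF w] ext_complement[OF r \<xi> w] iN by auto
    then show ?thesis using eq vtx_in[OF w] lev_vtx[OF w] 2 by simp
  next
    case 3
    then have l: "lev (vtx w) = i" using lev_vtx[OF w] iN by simp
    then have "part (vtx w) \<noteq> w" using 3(1) by metis
    then have "part (vtx w) = S - w" using part_vtx[OF w] by simp
    then show ?thesis using eq vtx_in[OF w] l 3 ext_complement[OF r \<xi> w] by simp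
  next
    case 4
    then have "lev (vtx w) \<noteq> i" using lev_vtx[OF w] iN le by auto
    then show ?thesis using eq 4 by simp
  qed
qed

end

section \<open>Block diagonalisation of the Terwilliger algebra\<close>

locale folded_cube_bases = folded_cube +
  fixes B :: "nat \<Rightarrow> (vertex \<Rightarrow> complex) set"
  assumes even_D: "even D"
    and B_basis: "\<And>r. r \<le> D \<Longrightarrow> orthonormal_basis_on X (B r) (\<lambda>\<xi>. \<xi>) (fc_L D lab r)"
    and B_real: "\<And>r \<xi> x. r \<le> D \<Longrightarrow> \<xi> \<in> B r \<Longrightarrow> \<xi> x \<in> \<real>"
begin

abbreviation "N \<equiv> fc_N D"
abbreviation "u \<equiv> fc_u D lab"

lemma B_span: "r \<le> D \<Longrightarrow> cvec.span (B r) = fc_L D lab r"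
  using B_basis[of r] by (simp add: orthonormal_basis_on_def)

lemma B_L: "r \<le> D \<Longrightarrow> \<xi> \<in> B r \<Longrightarrow> \<xi> \<in> fc_L D lab r"
  using B_span cvec.span_base by blast

lemma u_eq:
  "r \<le> D \<Longrightarrow> \<xi> \<in> B r \<Longrightarrow> i \<in> N r \<Longrightarrow>
     u r \<xi> i x = (if x \<in> X \<and> lev x = i then of_real (coef r i) * ext r \<xi> (part x) else 0)"
  using fc_u_eq[OF even_D _ B_L] by blast

lemma u_Reals: "r \<le> D \<Longrightarrow> \<xi> \<in> B r \<Longrightarrow> i \<in> N r \<Longrightarrow> u r \<xi> i x \<in> \<real>"
  using ext_Reals[OF B_real] by (auto simp: u_eq intro!: Reals_mult)

text \<open>At level \<open>D\<close> both \<open>r\<close> and \<open>r'\<close> are even, so the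
  summand is invariant under complementation and the subset sum counts each vertex twice.\<close>

lemma sum_lev_ext:
  assumes r: "r \<le> D" "\<xi> \<in> B r" "i \<in> N r" and r': "r' \<le> D" "\<xi>' \<in> B r'" "i \<in> N r'"
  shows "(\<Sum>x | x \<in> X \<and> lev x = i. ext r \<xi> (part x) * ext r' \<xi>' (part x))
    = level_inner S i (ext r \<xi>) (ext r' \<xi>') / (if i = D then 2 else 1)"
proof -
  have real: "cnj (ext r \<xi> w) = ext r \<xi> w" for w
    using ext_Reals[OF B_real[OF r(1,2)]] by (simp add: Reals_cnj_iff)
  have inner: "level_inner S i (ext r \<xi>) (ext r' \<xi>')
      = (\<Sum>w\<in>level S i. ext r \<xi> (part (vtx w)) * ext r' \<xi>' (part (vtx w)))"
    unfolding level_inner_def real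
  proof (rule sum.cong[OF refl])
    fix w assume "w \<in> level S i"
    then have w: "w \<subseteq> S" "card w = i" by (auto simp: level_def)
    show "ext r \<xi> w * ext r' \<xi>' w = ext r \<xi> (part (vtx w)) * ext r' \<xi>' (part (vtx w))"
    proof (cases "i = D")
      case True
      then show ?thesis
        using part_vtx[OF w(1)] fc_N_D(3)[OF r(3)] fc_N_D(3)[OF r'(3)]
          ext_complement[OF r(1) B_L[OF r(1,2)] w(1)] ext_complement[OF r'(1) B_L[OF r'(1,2)] w(1)] by auto
    next
      case False
      then show ?thesis using part_vtx_small[OF w(1)] fc_N_D(2)[OF r(3)] w(2) by simp
    qed
  qed
  show ?thesis
  proof (cases "i = D")
    case True
    then show ?thesis
      using sum_lev_D[of "\<lambda>x. ext r \<xi> (part x) * ext r' \<xi>' (part x)"] inner by simp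
  next
    case False
    then show ?thesis
      using sum_lev_small[of i "\<lambda>x. ext r \<xi> (part x) * ext r' \<xi>' (part x)"] inner fc_N_D(2)[OF r(3)] by simp
  qed
qed

text \<open>Evenness of \<open>D\<close> is what puts \<open>D\<close> into
  \<open>N D\<close>.\<close>

lemma r_in_N: "r \<le> D \<Longrightarrow> r \<in> N r"
  using even_D by (auto simp: fc_N_def le_eq_less_or_eq)

lemma u_self: "r \<le> D \<Longrightarrow> \<xi> \<in> B r \<Longrightarrow> u r \<xi> r = \<xi>"
proof
  fix x assume *: "r \<le> D" "\<xi> \<in> B r"
  show "u r \<xi> r x = \<xi> x"
    using u_eq[OF * r_in_N[OF *(1)], of x] fc_L_D[OF *(1) B_L[OF *], of x]
      ext_self[OF *(1) B_L[OF *] part_sub, of x] vtx_part[of x] *(1)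
    by (auto simp: coef_def)
qed

lemma level_inner_ext_self:
  assumes "r \<le> D" "\<xi> \<in> B r" "\<xi>' \<in> B r"
  shows "level_inner S r (ext r \<xi>) (ext r \<xi>') = (if \<xi> = \<xi>' then (if r = D then 2 else 1) else 0)"
proof -
  have "(if \<xi> = \<xi>' then 1 else 0) = cinner_on X \<xi> \<xi>'"
    using B_basis[OF assms(1)] assms(2,3) by (simp add: orthonormal_basis_on_def)
  also have "\<dots> = (\<Sum>x\<in>X. if lev x = r then ext r \<xi> (part x) * ext r \<xi>' (part x) else 0)"
    unfolding cinner_on_def
  proof (rule sum.cong[OF refl])
    fix x assume x: "x \<in> X"
    have "cnj (\<xi> x) = \<xi> x" using B_real[OF assms(1,2)] by (simp add: Reals_cnj_iff)
    moreover have "lev x = r \<Longrightarrow> ext r \<xi> (part x) = \<xi> x \<and> ext r \<xi>' (part x) = \<xi>' x"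
      using ext_self[OF assms(1) B_L part_sub[OF x]] assms vtx_part[OF x] by simp
    ultimately show "cnj (\<xi> x) * \<xi>' x = (if lev x = r then ext r \<xi> (part x) * ext r \<xi>' (part x) else 0)"
      using fc_L_D(2)[OF assms(1) B_L[OF assms(1,2)] x] by simp
  qed
  also have "\<dots> = (\<Sum>x | x \<in> X \<and> lev x = r. ext r \<xi> (part x) * ext r \<xi>' (part x))"
    by (rule sum.inter_filter[symmetric]) simp
  also have "\<dots> = level_inner S r (ext r \<xi>) (ext r \<xi>') / (if r = D then 2 else 1)"
    using assms r_in_N by (intro sum_lev_ext) auto
  finally show ?thesis by (auto simp: field_simps split: if_splits)
qed

text \<open>Columns of different levels have disjoint supports. On a common level, different
  \<open>r\<close> are orthogonal as ladder functions, and equal \<open>r\<close> reduce to the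
  orthonormality of \<open>B r\<close> by the binomial norm.\<close>

lemma u_inner:
  assumes r: "r \<le> D" "\<xi> \<in> B r" "i \<in> N r" and r': "r' \<le> D" "\<xi>' \<in> B r'" "i' \<in> N r'"
  shows "(\<Sum>x\<in>X. u r \<xi> i x * u r' \<xi>' i' x) = (if (r, \<xi>, i) = (r', \<xi>', i') then 1 else 0)"
proof (cases "i = i'")
  case False
  then have "(\<Sum>x\<in>X. u r \<xi> i x * u r' \<xi>' i' x) = 0"
    by (intro sum.neutral) (auto simp: u_eq[OF r] u_eq[OF r'])
  then show ?thesis using False by simp
next
  case True
  define e where "e = (if i = D then 2 else 1 :: complex)"
  have "(\<Sum>x\<in>X. u r \<xi> i x * u r' \<xi>' i' x) = (\<Sum>x\<in>X. if lev x = i then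
      of_real (coef r i * coef r' i) * (ext r \<xi> (part x) * ext r' \<xi>' (part x)) else 0)"
  proof (rule sum.cong[OF refl])
    fix x assume "x \<in> X"
    then show "u r \<xi> i x * u r' \<xi>' i' x
        = (if lev x = i then of_real (coef r i * coef r' i) * (ext r \<xi> (part x) * ext r' \<xi>' (part x)) else 0)"
      using u_eq[OF r, of x] u_eq[OF r', of x] True by simp
  qed
  also have "\<dots> = (\<Sum>x | x \<in> X \<and> lev x = i. of_real (coef r i * coef r' i) * (ext r \<xi> (part x) * ext r' \<xi>' (part x)))"
    by (rule sum.inter_filter[symmetric]) simp
  also have "\<dots> = of_real (coef r i * coef r' i) * (level_inner S i (ext r \<xi>) (ext r' \<xi>') / e)"
    using sum_lev_ext[OF r r'(1,2)] r' True by (simp add: e_def flip: sum_distrib_left)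
  finally have sum_eq: "(\<Sum>x\<in>X. u r \<xi> i x * u r' \<xi>' i' x)
      = of_real (coef r i * coef r' i) * (level_inner S i (ext r \<xi>) (ext r' \<xi>') / e)" .
  have ladders: "ladder S r (ext r \<xi>)" "ladder S r' (ext r' \<xi>')"
    using ladder_ext B_L r r' by auto
  show ?thesis
  proof (cases "r = r'")
    case False
    then show ?thesis using sum_eq level_inner_orthogonal[OF finite_S ladders] by simp
  next
    case rr: True
    have ri: "r \<le> i" "i \<le> D" using fc_N_D[OF r(3)] by auto
    define b where "b = (2 * D - 2 * r) choose (i - r)"
    have b: "b > 0" using ri by (simp add: b_def)
    have "level_inner S i (ext r \<xi>) (ext r' \<xi>') = of_nat b * level_inner S r (ext r \<xi>) (ext r' \<xi>')"
      using level_inner_binomial[OF finite_S ladders(1), of "ext r' \<xi>'" "i - r"] ladders rr ri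
      by (simp add: b_def)
    also have "level_inner S r (ext r \<xi>) (ext r' \<xi>') = (if \<xi> = \<xi>' then (if r = D then 2 else 1) else 0)"
      using level_inner_ext_self[of r \<xi> \<xi>'] r r' rr by simp
    finally have inner: "level_inner S i (ext r \<xi>) (ext r' \<xi>')
        = of_nat b * (if \<xi> = \<xi>' then (if r = D then 2 else 1) else 0)" .
    \<comment> \<open>The identity for which \<open>coef\<close> is designed: the factor 2 on either
      side counts the two lifts of a vertex of level \<open>D\<close>.\<close>
    have "coef r i * coef r i * real b * (if r = D then 2 else 1) = (if i = D then 2 else 1)"
    proof (cases "r = D")
      case True
      then have "coef r i = 1" "b = 1" "i = D" using ri unfolding coef_def b_def by simp_all
      then show ?thesis using True by simp
    next
      case False
      have "coef r i * coef r i = (if i = D then 2 else 1) / real b"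
        using False b ri by (simp add: coef_def flip: b_def)
      then show ?thesis using False b by simp
    qed
    then have "(of_real (coef r i * coef r i * real b * (if r = D then 2 else 1)) :: complex)
        = of_real (if i = D then 2 else 1)"
      by (simp only:)
    then have "of_real (coef r i * coef r i) * (of_nat b * (if r = D then 2 else 1)) = e"
      unfolding e_def by (cases "r = D"; cases "i = D") (simp_all add: mult.assoc)
    then show ?thesis
      using sum_eq inner rr True by (auto simp: e_def)
  qed
qed

text \<open>The matrix of \<open>A\<^sub>1\<close> on block \<open>r\<close>.\<close>

definition shift :: "nat \<Rightarrow> nat \<Rightarrow> nat \<Rightarrow> complex" where
  "shift r a b = of_real (coef r b / coef r a) *
     (if a = Suc b then (of_nat a - of_nat r) * (if a = D then 2 else 1)
      else if b = Suc a then of_nat (2 * D) - of_nat a - of_nat r else 0)"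

text \<open>Evaluated at a vertex of level \<open>j\<close>, the lowering and raising sums are both
  multiples of the extension there; dividing by \<open>coef r j\<close> expresses them in the column
  of level \<open>j\<close>.\<close>

lemma mat_vec_A1_u:
  assumes r: "r \<le> D" "\<xi> \<in> B r" "i \<in> N r"
  shows "mat_vec X (fc_A D lab 1) (u r \<xi> i) x = (\<Sum>a\<in>N r. shift r a i * u r \<xi> a x)"
proof (cases "x \<in> X")
  case False
  then show ?thesis using r by (simp add: u_eq mat_vec_def fc_A_def)
next
  case x: True
  define a where "a = part x"
  define j where "j = card a"
  have a: "a \<subseteq> S" "vtx a = x" and j: "j \<le> D" "lev x = j"
    using part_sub vtx_part lev_le x by (auto simp: a_def j_def)
  note i = fc_N_D[OF r(3)]
  note L = B_L[OF r(1,2)]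
  have fin: "finite a" using a finite_sub by blast
  define c where "c = (of_real (coef r i) :: complex)"
  define F where "F = ext r \<xi>"
  have ladder: "(\<Sum>s\<in>a. F (a - {s})) = (of_nat j - of_nat r) * F a"
    "(\<Sum>s\<in>S - a. F (insert s a)) = (of_nat (2 * D) - of_nat j - of_nat r) * F a"
    "j < r \<Longrightarrow> F a = 0"
    using ladder_ext[OF r(1) L] a unfolding ladder_def F_def j_def by auto
  have val: "u r \<xi> i (vtx w) = c * (if card w = i then F w else if card w = 2 * D - i then (-1) ^ r * F w else 0)"
    if "w \<subseteq> S" for w
    using fc_u_vtx[OF even_D r(1) L r(3) that] by (simp add: c_def F_def)
  have down: "(\<Sum>s\<in>a. u r \<xi> i (vtx (a - {s}))) = (if j = Suc i then c * ((of_nat j - of_nat r) * F a) else 0)"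
  proof -
    have "u r \<xi> i (vtx (a - {s})) = (if j = Suc i then c * F (a - {s}) else 0)" if s: "s \<in> a" for s
    proof -
      have "j > 0" using s fin by (auto simp: j_def card_gt_0_iff)
      moreover have "card (a - {s}) = j - 1" using s fin by (simp add: j_def)
      moreover have "a - {s} \<subseteq> S" using a by auto
      moreover have "j - 1 \<noteq> 2 * D - i" using \<open>j > 0\<close> j(1) i(2) by linarith
      moreover have "j - 1 = i \<longleftrightarrow> j = Suc i" using \<open>j > 0\<close> by auto
      ultimately show ?thesis using val[of "a - {s}"] by simp
    qed
    then show ?thesis using ladder(1) by (simp flip: sum_distrib_left)
  qed
  \<comment> \<open>Inserting into a \<open>D\<close>-set gives a vertex of level
    \<open>D - 1\<close>, read off through its complement; this is the extra branch with the
    sign.\<close>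
  have up: "(\<Sum>s\<in>S - a. u r \<xi> i (vtx (insert s a)))
      = (if Suc j = i then c * ((of_nat (2 * D) - of_nat j - of_nat r) * F a)
         else if j = D \<and> Suc i = D then c * ((-1) ^ r * ((of_nat (2 * D) - of_nat j - of_nat r) * F a)) else 0)"
  proof -
    have "u r \<xi> i (vtx (insert s a)) = (if Suc j = i then c * F (insert s a)
        else if j = D \<and> Suc i = D then c * ((-1) ^ r * F (insert s a)) else 0)" if s: "s \<in> S - a" for s
    proof -
      have "card (insert s a) = Suc j" using s fin by (simp add: j_def)
      moreover have "Suc j = 2 * D - i \<longleftrightarrow> j = D \<and> Suc i = D" if "Suc j \<noteq> i"
        using that j i by auto
      ultimately show ?thesis using val[of "insert s a"] a s by auto
    qed
    then have "(\<Sum>s\<in>S - a. u r \<xi> i (vtx (insert s a))) = (\<Sum>s\<in>S - a. if Suc j = i then c * F (insert s a)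
        else if j = D \<and> Suc i = D then c * ((-1) ^ r * F (insert s a)) else 0)"
      by (rule sum.cong[OF refl])
    also have "\<dots> = (if Suc j = i then c * (\<Sum>s\<in>S - a. F (insert s a))
        else if j = D \<and> Suc i = D then c * ((-1) ^ r * (\<Sum>s\<in>S - a. F (insert s a))) else 0)"
      by (auto simp: sum_distrib_left)
    finally show ?thesis unfolding ladder(2) .
  qed
  have lhs: "mat_vec X (fc_A D lab 1) (u r \<xi> i) x
      = (if j = Suc i then c * ((of_nat j - of_nat r) * F a) else 0)
      + (if Suc j = i then c * ((of_nat (2 * D) - of_nat j - of_nat r) * F a)
         else if j = D \<and> Suc i = D then c * ((-1) ^ r * ((of_nat (2 * D) - of_nat j - of_nat r) * F a)) else 0)"
    using mat_vec_A1[OF a(1), of "u r \<xi> i"] a(2) down up by simp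
  have "(\<Sum>k\<in>N r. shift r k i * u r \<xi> k x)
      = (\<Sum>k\<in>N r. if k = j then shift r j i * (of_real (coef r j) * F a) else 0)"
    using u_eq[OF r(1,2)] x j by (intro sum.cong) (auto simp: F_def a_def)
  also have "\<dots> = (if j \<in> N r then shift r j i * (of_real (coef r j) * F a) else 0)"
    by (simp add: fc_N_def)
  finally have rhs: "(\<Sum>k\<in>N r. shift r k i * u r \<xi> k x)
      = (if j \<in> N r then shift r j i * (of_real (coef r j) * F a) else 0)" .
  show ?thesis
  proof (cases "j \<in> N r")
    case True
    then have "coef r j \<noteq> 0" using coef_pos[of r j] fc_N_D[OF True] by simp
    then have sh: "shift r j i * (of_real (coef r j) * F a) = c * (if j = Suc i then (of_nat j - of_nat r) * (if j = D then 2 else 1)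
      else if i = Suc j then of_nat (2 * D) - of_nat j - of_nat r else 0) * F a"
      by (simp add: shift_def c_def)
    \<comment> \<open>At level \<open>D\<close> deletions and insertions contribute equally for even
      \<open>r\<close>, whence the factor 2 in \<open>shift\<close>.\<close>
    have "even r" if "j = D" using fc_N_D(3)[OF True that] .
    then show ?thesis
      unfolding lhs rhs sh using True by (auto simp: algebra_simps)
  next
    case False
    \<comment> \<open>Nothing may remain at a level outside \<open>N r\<close>: below
      \<open>r\<close> the extension vanishes, and at level \<open>D\<close> with odd
      \<open>r\<close> the two contributions cancel.\<close>
    then have "j < r \<or> (j = D \<and> odd r)"
      using j r even_D by (auto simp: fc_N_def split: if_splits)
    then show ?thesis
      unfolding lhs rhs using False ladder(3) i by (auto simp: algebra_simps)
  qed
qed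

lemma shift_nonzero:
  assumes "r \<le> D" "i \<in> N r" "Suc i \<in> N r"
  shows "shift r (Suc i) i \<noteq> 0" "shift r i (Suc i) \<noteq> 0"
proof -
  have i: "r \<le> i" "Suc i \<le> D" using fc_N_D(1)[OF assms(2)] fc_N_D(2)[OF assms(3)] by auto
  then have "coef r i > 0" "coef r (Suc i) > 0" by (auto intro: coef_pos)
  moreover have "of_nat (Suc i) - of_nat r \<noteq> (0 :: complex)" using i by (metis Suc_n_not_le_n eq_iff_diff_eq_0 of_nat_eq_iff)
  moreover have "of_nat (2 * D) - of_nat i - of_nat r \<noteq> (0 :: complex)"
  proof -
    have "of_nat (2 * D) - of_nat i - of_nat r = (of_nat (2 * D - i - r) :: complex)"
      using i assms(1) by (simp add: of_nat_diff)
    moreover have "2 * D - i - r \<noteq> 0" using i assms(1) by simp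
    ultimately show ?thesis by (metis of_nat_eq_0_iff)
  qed
  ultimately show "shift r (Suc i) i \<noteq> 0" "shift r i (Suc i) \<noteq> 0"
    unfolding shift_def by (simp_all del: of_nat_Suc of_nat_mult)
qed

section \<open>Completeness of the columns\<close>

lemma fc_L_orthogonal_zero:
  assumes i: "i \<le> D" and w: "w \<in> fc_L D lab i"
    and orth: "\<And>\<xi>. \<xi> \<in> B i \<Longrightarrow> (\<Sum>x\<in>X. \<xi> x * w x) = 0"
  shows "w = 0"
proof -
  have "cinner_on X w w = 0"
  proof -
    have "w \<in> cvec.span (B i)" using w B_span[OF i] by simp
    then show ?thesis
    \<comment> \<open>The vectors orthogonal to \<open>w\<close> form a subspace containing
      \<open>B i\<close>, hence also \<open>w\<close> itself.\<close>
    proof (rule cvec.span_induct[where P = "\<lambda>v. cinner_on X v w = 0"])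
      show "cvec.subspace {v. cinner_on X v w = 0}"
        by (auto simp: cvec.subspace_def cinner_on_def cscale_def distrib_right sum.distrib mult.assoc
            simp flip: sum_distrib_left)
      fix \<xi> assume \<xi>: "\<xi> \<in> B i"
      then have "cnj (\<xi> x) = \<xi> x" for x using B_real[OF i \<xi>] by (simp add: Reals_cnj_iff)
      then show "cinner_on X \<xi> w = 0" using orth[OF \<xi>] by (simp add: cinner_on_def)
    qed
  qed
  moreover have "of_real (\<Sum>x\<in>X. (cmod (w x))\<^sup>2) = cinner_on X w w"
    unfolding cinner_on_def of_real_sum complex_norm_square by (simp add: mult.commute)
  ultimately have "of_real (\<Sum>x\<in>X. (cmod (w x))\<^sup>2) = (0 :: complex)" by simp
  then have "(\<Sum>x\<in>X. (cmod (w x))\<^sup>2) = 0" by (simp only: of_real_eq_0_iff)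
  then have "w x = 0" if "x \<in> X" for x
    using that by (subst (asm) sum_nonneg_eq_0_iff) auto
  then show ?thesis using fc_L_D(1)[OF i w] by (auto simp: fun_eq_iff)
qed

text \<open>Induction on the level: the lowered vector \<open>v\<close> is orthogonal to all columns
  of level \<open>i\<close>, hence 0. So \<open>w\<close> lies in
  \<open>\<L>\<^sub>i\<^sub>+\<^sub>1\<close>, where orthogonality to the columns from
  \<open>B (Suc i)\<close> forces \<open>w = 0\<close>.\<close>

lemma level_complete:
  assumes "i \<le> D" "w \<in> cvectors X" "\<And>x. x \<in> X \<Longrightarrow> lev x \<noteq> i \<Longrightarrow> w x = 0"
    and "\<And>r \<xi>. r \<le> D \<Longrightarrow> \<xi> \<in> B r \<Longrightarrow> i \<in> N r \<Longrightarrow> (\<Sum>x\<in>X. u r \<xi> i x * w x) = 0"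
  shows "w = 0"
  using assms
proof (induction i arbitrary: w)
  case (0 w)
  then have "w \<in> fc_L D lab 0" by (auto simp: fc_L_iff)
  moreover have "(\<Sum>x\<in>X. \<xi> x * w x) = 0" if "\<xi> \<in> B 0" for \<xi>
    using "0.prems"(4)[of 0 \<xi>] that u_self[of 0 \<xi>] r_in_N[of 0] by simp
  ultimately show ?case by (intro fc_L_orthogonal_zero[of 0]) auto
next
  case (Suc i w)
  define v where "v x = (if x \<in> X \<and> lev x = i then mat_vec X (fc_A D lab 1) w x else 0)" for x
  have "v = 0"
  proof (rule Suc.IH)
    show "i \<le> D" "v \<in> cvectors X" "\<And>x. x \<in> X \<Longrightarrow> lev x \<noteq> i \<Longrightarrow> v x = 0"
      using Suc.prems by (auto simp: v_def cvectors_def)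
    fix r \<xi> assume r: "r \<le> D" "\<xi> \<in> B r" "i \<in> N r"
    have "(\<Sum>x\<in>X. u r \<xi> i x * v x) = (\<Sum>x\<in>X. u r \<xi> i x * mat_vec X (fc_A D lab 1) w x)"
      by (rule sum.cong) (auto simp: v_def u_eq[OF r])
    \<comment> \<open>Symmetry of \<open>A\<^sub>1\<close> moves it onto the column, where its
      action is known.\<close>
    also have "\<dots> = (\<Sum>x\<in>X. \<Sum>y\<in>X. fc_A D lab 1 y x * u r \<xi> i x * w y)"
      unfolding mat_vec_def sum_distrib_left by (intro sum.cong refl) (simp add: fc_A_sym mult_ac)
    also have "\<dots> = (\<Sum>y\<in>X. mat_vec X (fc_A D lab 1) (u r \<xi> i) y * w y)"
      unfolding mat_vec_def sum_distrib_right by (rule sum.swap)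
    also have "\<dots> = (\<Sum>y\<in>X. \<Sum>a\<in>N r. shift r a i * (u r \<xi> a y * w y))"
      by (simp only: mat_vec_A1_u[OF r] sum_distrib_right mult.assoc)
    also have "\<dots> = (\<Sum>a\<in>N r. shift r a i * (\<Sum>y\<in>X. u r \<xi> a y * w y))"
      unfolding sum_distrib_left by (rule sum.swap)
    also have "\<dots> = 0"
    proof (rule sum.neutral, rule ballI)
      fix a assume a: "a \<in> N r"
      \<comment> \<open>Only the column of level \<open>Suc i\<close> meets the support of
        \<open>w\<close>, and it is orthogonal by assumption.\<close>
      have "(\<Sum>y\<in>X. u r \<xi> a y * w y) = 0"
      proof (cases "a = Suc i")
        case True
        then show ?thesis using Suc.prems(4) r a by simp
      next
        case False
        then show ?thesis
          using Suc.prems(3) by (intro sum.neutral) (auto simp: u_eq[OF r(1,2) a])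
      qed
      then show "shift r a i * (\<Sum>y\<in>X. u r \<xi> a y * w y) = 0" by simp
    qed
    finally show "(\<Sum>x\<in>X. u r \<xi> i x * v x) = 0" .
  qed
  then have "mat_vec X (fc_A D lab 1) w x = 0" if "x \<in> X" "lev x = i" for x
    using that by (metis v_def zero_fun_apply)
  then have "w \<in> fc_L D lab (Suc i)"
    using Suc.prems fc_L_iff[of "Suc i" w] by auto
  moreover have "(\<Sum>x\<in>X. \<xi> x * w x) = 0" if "\<xi> \<in> B (Suc i)" for \<xi>
    using Suc.prems(4)[of "Suc i" \<xi>] that u_self[of "Suc i" \<xi>] r_in_N[of "Suc i"] Suc.prems(1) by simp
  ultimately show ?case using Suc.prems(1) by (intro fc_L_orthogonal_zero[of "Suc i"]) auto
qed

text \<open>Each column lives on one level, so the restriction of \<open>w\<close> to a level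
  inherits the orthogonality.\<close>

lemma u_complete:
  assumes w: "w \<in> cvectors X"
    and orth: "\<And>r \<xi> i. r \<le> D \<Longrightarrow> \<xi> \<in> B r \<Longrightarrow> i \<in> N r \<Longrightarrow> (\<Sum>x\<in>X. u r \<xi> i x * w x) = 0"
  shows "w = 0"
proof
  fix x
  show "w x = 0 x"
  proof (cases "x \<in> X")
    case True
    define v where "v y = (if y \<in> X \<and> lev y = lev x then w y else 0)" for y
    have "v = 0"
    proof (rule level_complete[of "lev x"])
      fix r \<xi> assume r: "r \<le> D" "\<xi> \<in> B r" "lev x \<in> N r"
      have "(\<Sum>y\<in>X. u r \<xi> (lev x) y * v y) = (\<Sum>y\<in>X. u r \<xi> (lev x) y * w y)"
        by (rule sum.cong) (auto simp: v_def u_eq[OF r])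
      then show "(\<Sum>y\<in>X. u r \<xi> (lev x) y * v y) = 0" using orth r by simp
    qed (use True lev_le in \<open>auto simp: v_def cvectors_def\<close>)
    then show ?thesis using True by (metis v_def zero_fun_apply)
  qed (use w in \<open>simp add: cvectors_def\<close>)
qed

text \<open>The function \<open>pair_product r\<close> yields a vector of
  \<open>\<L>\<^sub>r\<close> with value 1 at the set of the first \<open>r\<close> odd
  numbers.\<close>

lemma B_nonempty:
  assumes r: "r \<le> D"
  shows "B r \<noteq> {}"
proof
  assume "B r = {}"
  then have L: "fc_L D lab r = {0}" using B_span[OF r] by simp
  have S: "S = {1..2 * D}" by (simp add: fc_ground_def)
  define \<xi> where "\<xi> x = (if x \<in> X \<and> lev x = r then pair_product r (part x) else 0)" for x
  have \<xi>: "\<xi> (vtx w) = pair_product r w" if w: "w \<subseteq> S" "card w = r" for w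
  proof -
    have "pair_product r (part (vtx w)) = pair_product r w"
    proof (cases "r = D")
      \<comment> \<open>Either half of a vertex may be its label here; the sign
        \<open>(-1) ^ D\<close> is 1.\<close>
      case True
      then show ?thesis
        using part_vtx[OF w(1)] pair_product_complement[of w D] even_D w by (auto simp: S)
    next
      case False
      then show ?thesis using part_vtx_small[OF w(1)] w r by simp
    qed
    then show ?thesis using lev_vtx[OF w(1)] vtx_in[OF w(1)] w r by (simp add: \<xi>_def)
  qed
  have "\<xi> \<in> fc_L D lab r"
    unfolding fc_L_iff[OF r]
  proof (intro conjI ballI impI)
    fix x assume x: "x \<in> X" "lev x + 1 = r"
    note p = part_sub[OF x(1)] vtx_part[OF x(1)]
    have "mat_vec X (fc_A D lab 1) \<xi> x = (\<Sum>s\<in>S - part x. \<xi> (vtx (insert s (part x))))"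
      using mat_vec_A1_low[OF r p(1) x(2), of \<xi>] p(2) by (simp add: \<xi>_def)
    also have "\<dots> = (\<Sum>s\<in>S - part x. pair_product r (insert s (part x)))"
      using x(2) p finite_sub by (intro sum.cong refl \<xi>) auto
    also have "\<dots> = 0" unfolding S by (rule sum_pair_product_insert[OF r])
    finally show "mat_vec X (fc_A D lab 1) \<xi> x = 0" .
  qed (auto simp: \<xi>_def cvectors_def)
  moreover
  define w where "w = (\<lambda>k. 2 * k - 1) ` {1..r}"
  have "card w = r"
    unfolding w_def by (subst card_image) (auto simp: inj_on_def)
  moreover have "w \<subseteq> S" using r by (auto simp: w_def S)
  ultimately show False using \<xi>[of w] pair_product_odds[of r] L by (simp add: w_def)
qed

section \<open>The Terwilliger algebra inside the block algebra\<close>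

sublocale block_basis X D N B u
proof
  show "finite (N r)" for r by (simp add: fc_N_def)
  show "u r \<xi> i \<in> cvectors X" if "r \<le> D" "\<xi> \<in> B r" "i \<in> N r" for r \<xi> i
    using u_eq[OF that] by (simp add: cvectors_def)
qed (use B_nonempty u_inner u_complete in auto)

lemma acts_A1: "acts (fc_A D lab 1) shift"
  using mat_vec_A1_u fc_A_mat_space by (auto simp: acts_def simp del: One_nat_def)

lemma acts_Estar: "acts (fc_Estar D lab k) (\<lambda>r a b. if a = k \<and> b = k then 1 else 0)"
  unfolding acts_def
proof (intro conjI allI impI ballI)
  show "fc_Estar D lab k \<in> mat_space X" by (rule fc_Estar_mat_space)
  fix r \<xi> j x assume r: "r \<le> D" "\<xi> \<in> B r" "j \<in> N r"
  have "(\<Sum>i\<in>N r. (if i = k \<and> j = k then 1 else 0) * u r \<xi> i x) = (\<Sum>i\<in>N r. if i = j then (if j = k then u r \<xi> j x else 0) else 0)"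
    by (rule sum.cong) auto
  also have "\<dots> = (if j = k then u r \<xi> j x else 0)" using r finite_N[of r] by simp
  finally show "mat_vec X (fc_Estar D lab k) (u r \<xi> j) x = (\<Sum>i\<in>N r. (if i = k \<and> j = k then 1 else 0) * u r \<xi> i x)"
    using u_eq[OF r, of x] by (auto simp: mat_vec_Estar)
qed

text \<open>Solving the recurrence for its leading term, whose coefficient is nonzero, makes
  \<open>A\<^sub>k\<close> a polynomial in \<open>A\<^sub>1\<close>.\<close>

lemma fc_A_block: "k \<le> D \<Longrightarrow> fc_A D lab k \<in> block_algebra"
proof (induction k rule: less_induct)
  case (less k)
  consider "k = 0" | "k = 1" | "k > 1" by linarith
  then show ?case
  proof cases
    case 1
    then show ?thesis using mat_subalgebra_block_algebra by (simp add: fc_A_0 mat_subalgebra_def)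
  next
    case 2
    then show ?thesis using acts_A1 by (auto simp: block_algebra_def)
  next
    case 3
    define c b :: complex
      where "c = of_nat (if k = D then 2 * D else k)" and "b = of_nat (2 * D - (k - 1) + 1)"
    have "c \<noteq> 0" using 3 less.prems by (simp add: c_def)
    have "mat_mul X (fc_A D lab 1) (fc_A D lab (k - 1))
        = mat_scale c (fc_A D lab k) + mat_scale b (fc_A D lab (k - 2))"
      using fc_A_recurrence[of "k - 1"] 3 less.prems by (simp add: c_def b_def numeral_2_eq_2)
    then have "fc_A D lab k = mat_scale (1 / c) (mat_mul X (fc_A D lab 1) (fc_A D lab (k - 1))
        + mat_scale (- b) (fc_A D lab (k - 2)))"
      using \<open>c \<noteq> 0\<close> by (simp add: mat_scale_def fun_eq_iff)
    moreover have "fc_A D lab 1 \<in> block_algebra" "fc_A D lab (k - 1) \<in> block_algebra" "fc_A D lab (k - 2) \<in> block_algebra"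
      using less 3 by auto
    ultimately show ?thesis
      using mat_subalgebra_block_algebra unfolding mat_subalgebra_def by metis
  qed
qed

lemma generators_in_T: "fc_A D lab ` {0..D} \<union> fc_Estar D lab ` {0..D} \<subseteq> fc_T D lab"
  by (auto simp: fc_T_def generated_subalgebra_def)

sublocale block_subalgebra X D N B u "fc_T D lab"
proof
  show "mat_subalgebra X (fc_T D lab)"
    unfolding fc_T_def
    by (rule mat_subalgebra_generated) (use fc_A_mat_space fc_Estar_mat_space in auto)
  have "fc_Estar D lab k \<in> block_algebra" for k using acts_Estar by (auto simp: block_algebra_def)
  then show "fc_T D lab \<subseteq> block_algebra"
    unfolding fc_T_def
    by (intro generated_subalgebra_minimal mat_subalgebra_block_algebra) (use fc_A_block in auto)
qed

lemma realizable_Estar: "k \<le> D \<Longrightarrow> realizable (\<lambda>r a b. if a = k \<and> b = k then 1 else 0)"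
  unfolding realizable_def using acts_Estar[of k] generators_in_T by fastforce

text \<open>Sandwiching \<open>A\<^sub>1\<close> between the projections to levels \<open>k\<close>
  and \<open>l\<close> isolates one entry in every block.\<close>

lemma realizable_shift:
  assumes "k \<le> D" "l \<le> D"
  shows "realizable (\<lambda>r a b. if a = k \<and> b = l then shift r k l else 0)"
proof -
  have "fc_A D lab 1 \<in> fc_T D lab" using generators_in_T D_gt by auto
  then have "realizable shift" unfolding realizable_def using acts_A1 by blast
  from realizable_mul[OF realizable_mul[OF realizable_Estar[OF assms(1)] this] realizable_Estar[OF assms(2)]]
  show ?thesis
  proof (rule realizable_cong)
    fix r a b assume r: "r \<le> D" "a \<in> N r" "b \<in> N r"
    have "(\<Sum>i\<in>N r. (if a = k \<and> i = k then 1 else 0) * shift r i m) = (if a = k then shift r k m else 0)" for m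
    proof -
      have "(\<Sum>i\<in>N r. (if a = k \<and> i = k then 1 else 0) * shift r i m)
          = (\<Sum>i\<in>N r. if i = a then (if a = k then shift r k m else 0) else 0)"
        by (rule sum.cong) auto
      then show ?thesis using r finite_N[of r] by simp
    qed
    then have "(\<Sum>m\<in>N r. (\<Sum>i\<in>N r. (if a = k \<and> i = k then 1 else 0) * shift r i m) * (if m = l \<and> b = l then 1 else 0))
        = (\<Sum>m\<in>N r. if m = b then (if a = k \<and> b = l then shift r k l else 0) else 0)"
      by (intro sum.cong) auto
    then show "(\<Sum>m\<in>N r. (\<Sum>i\<in>N r. (if a = k \<and> i = k then 1 else 0) * shift r i m) * (if m = l \<and> b = l then 1 else 0))
        = (if a = k \<and> b = l then shift r k l else 0)"
      using r finite_N[of r] by simp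
  qed
qed

text \<open>The isolated entries next to the diagonal of \<open>A\<^sub>1\<close> serve as raising
  and lowering steps; they are nonzero wherever both indices belong to the block.\<close>

lemma iso_fc_T: "iso_to_block_sum X (fc_T D lab) D N"
proof (rule iso_to_block_sum_if_units)
  show "realizable (unit_block r i j)" if "r \<le> D" "i \<in> N r" "j \<in> N r" for r i j
  proof (rule realizable_units[where \<alpha> = "\<lambda>i r. shift r (Suc i) i" and \<beta> = "\<lambda>i r. shift r i (Suc i)"])
    show "N r \<subseteq> {r..D}" for r by (auto simp: fc_N_def)
    show "j \<in> N r" if "i \<in> N r" "r \<le> j" "j \<le> i" for r i j using that by (auto simp: fc_N_def split: if_splits)
  qed (use that in \<open>auto intro: r_in_N realizable_Estar realizable_shift simp: shift_nonzero\<close>)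
qed

lemma fc_conj_eq:
  "fc_conj D lab M (r, \<xi>, i) (r', \<xi>', j) = (\<Sum>x\<in>X. u r \<xi> i x * mat_vec X M (u r' \<xi>' j) x)"
proof -
  have "fc_conj D lab M (r, \<xi>, i) (r', \<xi>', j) = (\<Sum>y\<in>X. \<Sum>x\<in>X. u r \<xi> i x * M x y * u r' \<xi>' j y)"
    by (simp add: fc_conj_def mat_mul_def mat_transpose_def fc_U1_def sum_distrib_right)
  also have "\<dots> = (\<Sum>x\<in>X. \<Sum>y\<in>X. u r \<xi> i x * M x y * u r' \<xi>' j y)"
    by (rule sum.swap)
  finally show ?thesis by (simp add: mat_vec_def sum_distrib_left mult.assoc)
qed

lemma fc_conj_off_block:
  assumes "M \<in> fc_T D lab" "r \<le> D" "\<xi> \<in> B r" "i \<in> N r" "r' \<le> D" "\<xi>' \<in> B r'" "j \<in> N r'" "(r, \<xi>) \<noteq> (r', \<xi>')"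
  shows "fc_conj D lab M (r, \<xi>, i) (r', \<xi>', j) = 0"
proof -
  obtain F where "acts M F" using assms T_block by (auto simp: block_algebra_def)
  from acts_entry[OF this assms(2-7)] show ?thesis using assms(8) by (simp only: fc_conj_eq if_False)
qed

lemma fc_conj_block:
  assumes "M \<in> fc_T D lab" "r \<le> D" "\<xi> \<in> B r" "\<xi>' \<in> B r" "i \<in> N r" "j \<in> N r"
  shows "fc_conj D lab M (r, \<xi>, i) (r, \<xi>, j) = fc_conj D lab M (r, \<xi>', i) (r, \<xi>', j)"
proof -
  obtain F where "acts M F" using assms T_block by (auto simp: block_algebra_def)
  from acts_entry[OF this, of r _ i r _ j] show ?thesis using assms by (simp add: fc_conj_eq)
qed

text \<open>Since the columns are real, the Hermitian inner product agrees with the bilinear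
  products used for the blocks.\<close>

lemma U1_basis: "orthonormal_basis_on X (fc_B1 D B) (\<lambda>b x. fc_U1 D lab x b) (cvectors X)"
proof (rule orthonormal_basis_onI)
  have cnj_u: "cnj (u r \<xi> i x) = u r \<xi> i x" if "r \<le> D" "\<xi> \<in> B r" "i \<in> N r" for r \<xi> i x
    using u_Reals[OF that] by (simp add: Reals_cnj_iff)
  show "(\<lambda>x. fc_U1 D lab x b) \<in> cvectors X" if "b \<in> fc_B1 D B" for b
    using that u_eq by (auto simp: fc_B1_def fc_U1_def cvectors_def)
  show "cinner_on X (\<lambda>x. fc_U1 D lab x a) (\<lambda>x. fc_U1 D lab x b) = (if a = b then 1 else 0)"
    if "a \<in> fc_B1 D B" "b \<in> fc_B1 D B" for a b
  proof -
    obtain r \<xi> i r' \<xi>' i' where ab: "a = (r, \<xi>, i)" "b = (r', \<xi>', i')" by (metis prod_cases3)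
    then have "r \<le> D" "\<xi> \<in> B r" "i \<in> N r" "r' \<le> D" "\<xi>' \<in> B r'" "i' \<in> N r'"
      using that by (auto simp: fc_B1_def)
    then show ?thesis
      using u_inner[of r \<xi> i r' \<xi>' i'] by (simp add: ab fc_U1_def cinner_on_def cnj_u)
  qed
  show "w = 0" if w: "w \<in> cvectors X" and orth: "\<And>b. b \<in> fc_B1 D B \<Longrightarrow> cinner_on X (\<lambda>x. fc_U1 D lab x b) w = 0" for w
  proof (rule u_complete[OF w])
    fix r \<xi> i assume r: "r \<le> D" "\<xi> \<in> B r" "i \<in> N r"
    then show "(\<Sum>x\<in>X. u r \<xi> i x * w x) = 0"
      using orth[of "(r, \<xi>, i)"] by (simp add: fc_B1_def fc_U1_def cinner_on_def cnj_u)
  qed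
qed simp

end

theorem theorem4p7:
  fixes D :: nat and lab :: labelling and B :: "nat \<Rightarrow> (vertex \<Rightarrow> complex) set"
  assumes "D > 3" and "even D"
    and "fc_labelling D lab"
    and "\<And>r. r \<le> D \<Longrightarrow> orthonormal_basis_on (fc_vertices D) (B r) (\<lambda>\<xi>. \<xi>) (fc_L D lab r)"
    and "\<And>r \<xi> x. r \<le> D \<Longrightarrow> \<xi> \<in> B r \<Longrightarrow> \<xi> x \<in> \<real>"
  shows "orthonormal_basis_on (fc_vertices D) (fc_B1 D B) (\<lambda>b x. fc_U1 D lab x b)
           (cvectors (fc_vertices D))
    \<and> (\<forall>M\<in>fc_T D lab.
         (\<forall>r \<xi> i r' \<xi>' j.
            (r, \<xi>, i) \<in> fc_B1 D B \<and> (r', \<xi>', j) \<in> fc_B1 D B \<and> (r, \<xi>) \<noteq> (r', \<xi>') \<longrightarrow>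
            fc_conj D lab M (r, \<xi>, i) (r', \<xi>', j) = 0) \<and>
         (\<forall>r\<le>D. \<forall>\<xi>\<in>B r. \<forall>\<xi>'\<in>B r. \<forall>i\<in>fc_N D r. \<forall>j\<in>fc_N D r.
            fc_conj D lab M (r, \<xi>, i) (r, \<xi>, j) = fc_conj D lab M (r, \<xi>', i) (r, \<xi>', j)))
    \<and> iso_to_block_sum (fc_vertices D) (fc_T D lab) D (fc_N D)"
proof -
  interpret folded_cube_bases D lab B
    using assms by unfold_locales auto
  show ?thesis
  proof (intro conjI ballI U1_basis iso_fc_T)
    fix M assume M: "M \<in> fc_T D lab"
    show "\<forall>r \<xi> i r' \<xi>' j.
        (r, \<xi>, i) \<in> fc_B1 D B \<and> (r', \<xi>', j) \<in> fc_B1 D B \<and> (r, \<xi>) \<noteq> (r', \<xi>') \<longrightarrow>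
        fc_conj D lab M (r, \<xi>, i) (r', \<xi>', j) = 0"
      using fc_conj_off_block[OF M] by (auto simp: fc_B1_def)
    show "\<forall>r\<le>D. \<forall>\<xi>\<in>B r. \<forall>\<xi>'\<in>B r. \<forall>i\<in>fc_N D r. \<forall>j\<in>fc_N D r.
        fc_conj D lab M (r, \<xi>, i) (r, \<xi>, j) = fc_conj D lab M (r, \<xi>', i) (r, \<xi>', j)"
      using fc_conj_block[OF M] by blast
  qed
qed

end
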